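(* For every $N\in\mathbb{N}$ there exists a holomorphic eta quotient $F_N$ of weight $\kappa(N)/2$ on $\Gamma_0(N)$ such that a holomorphic eta quotient $h$ on $\Gamma_0(N)$ is divisible by $F_N$ if and only if $h$ is divisible by every holomorphic eta quotient on $\Gamma_0(N)$ which is not factorizable on $\Gamma_0(N)$.
   Context: Let $\eta(z)=q^{1/24}\prod_{n\ge1}(1-q^n)$, $q=e^{2\pi i z}$, $z$ in the upper half plane, and $\eta_d(z)=\eta(dz)$. An eta quotient is a finite product $\prod_d\eta_d^{X_d}$, $X_d\in\mathbb{Z}$; its level is $\operatorname{lcm}\{d:X_d\ne0\}$, its weight $\frac12\sum_dX_d$. An eta quotient on $\Gamma_0(M)$ is one whose level divides $M$. With $\mathcal{D}_N$ the set of positive divisors of $N$, each eta quotient on $\Gamma_0(N)$ is uniquely $\eta^X=\prod_{d\in\mathcal{D}_N}\eta_d^{X_d}$, and it is holomorphic (no poles at the cusps of $\Gamma_0(N)$) iff $\sum_{d\in\mathcal{D}_N}\frac{N\gcd(d,t)^2}{d\gcd(t^2,N)}X_d\ge0$ for all $t\in\mathcal{D}_N$. A holomorphic eta quotient $f$ is divisible by a holomorphic eta quotient $g$ if $f/g$ is holomorphic. $f$ is factorizable on $\Gamma_0(M)$ if $f=gh$ with $g,h$ nonconstant holomorphic eta quotients on $\Gamma_0(M)$. $\kappa(N)=\varphi(\mathrm{rad}(N))\prod_{p^n\|N}((n-1)(p-1)+2)$, where $\varphi$ is Euler's totient, $\mathrm{rad}(N)$ the product of the distinct primes dividing $N$,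 and the product runs over primes $p\mid N$ with $p^n$ the exact power of $p$ dividing $N$. *)

theory Defs
  imports "HOL-Complex_Analysis.Complex_Analysis" "HOL-Number_Theory.Number_Theory"
begin

definition dedekind_eta :: "complex \<Rightarrow> complex" where
  "dedekind_eta z =
     exp (2 * of_real pi * \<i> * z / 24) *
     (\<Prod>n. 1 - exp (2 * of_real pi * \<i> * z) ^ Suc n)"

(* Exponents are indexed by d in nat; the value X 0 has no meaning and is required to be 0. *)
definition eta_exponents :: "(nat \<Rightarrow> int) \<Rightarrow> bool" where
  "eta_exponents X \<longleftrightarrow> finite {d. X d \<noteq> 0} \<and> X 0 = 0"

(* Functions on the upper half plane are represented by functions on the complex numbers that
   vanish outside it. Pointwise products and quotients preserve this convention (0 / 0 = 0), so
   equality in HOL is equality on the upper half plane. *)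
definition eta_quotient :: "(nat \<Rightarrow> int) \<Rightarrow> complex \<Rightarrow> complex" where
  "eta_quotient X = (\<lambda>z.
     if Im z > 0 then \<Prod>d | X d \<noteq> 0. dedekind_eta (of_nat d * z) powi X d else 0)"

definition eta_level :: "(nat \<Rightarrow> int) \<Rightarrow> nat" where
  "eta_level X = Lcm {d. X d \<noteq> 0}"

definition eta_weight :: "(nat \<Rightarrow> int) \<Rightarrow> real" where
  "eta_weight X = of_int (\<Sum>d | X d \<noteq> 0. X d) / 2"

(* An eta quotient determines its exponents, hence its weight and its level; the notions for
   functions below therefore do not depend on the choice of X. *)
definition has_eta_weight :: "(complex \<Rightarrow> complex) \<Rightarrow> real \<Rightarrow> bool" where
  "has_eta_weight f k \<longleftrightarrow>
     (\<exists>X. eta_exponents X \<and> f = eta_quotient X \<and> k = eta_weight X)"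

definition eta_quotient_on :: "nat \<Rightarrow> (complex \<Rightarrow> complex) \<Rightarrow> bool" where
  "eta_quotient_on M f \<longleftrightarrow>
     (\<exists>X. eta_exponents X \<and> f = eta_quotient X \<and> eta_level X dvd M)"

(* For every gamma = (a b; c d) in SL_2(Z), the weight k transform
   (c z + d)^(-k) f (gamma z) stays bounded as Im z tends to infinity, i.e. f has no pole at the
   cusp gamma(infinity) = a / c. Every element of P^1(Q) is of this form, so this covers the cusps
   of each Gamma_0(N). Only absolute values occur, so for half-integral k no branch of
   (c z + d)^k has to be chosen. *)
definition no_poles_at_cusps :: "real \<Rightarrow> (complex \<Rightarrow> complex) \<Rightarrow> bool" where
  "no_poles_at_cusps k f \<longleftrightarrow>
     (\<forall>a b c d :: int. a * d - b * c = 1 \<longrightarrow>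
       (\<exists>y>0. \<exists>B. \<forall>z. Im z > y \<longrightarrow>
          norm (of_int c * z + of_int d) powr (-k) *
          norm (f (moebius (of_int a) (of_int b) (of_int c) (of_int d) z)) \<le> B))"

(* Holomorphy on the upper half plane itself is automatic, since eta has no zeros there. *)
definition holomorphic_eta_quotient :: "(complex \<Rightarrow> complex) \<Rightarrow> bool" where
  "holomorphic_eta_quotient f \<longleftrightarrow> (\<exists>k. has_eta_weight f k \<and> no_poles_at_cusps k f)"

definition holomorphic_eta_quotient_on :: "nat \<Rightarrow> (complex \<Rightarrow> complex) \<Rightarrow> bool" where
  "holomorphic_eta_quotient_on M f \<longleftrightarrow> holomorphic_eta_quotient f \<and> eta_quotient_on M f"

definition eta_divisible_by :: "(complex \<Rightarrow> complex) \<Rightarrow> (complex \<Rightarrow> complex) \<Rightarrow> bool" where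
  "eta_divisible_by f g \<longleftrightarrow>
     holomorphic_eta_quotient f \<and> holomorphic_eta_quotient g \<and>
     holomorphic_eta_quotient (\<lambda>z. f z / g z)"

definition eta_factorizable_on :: "nat \<Rightarrow> (complex \<Rightarrow> complex) \<Rightarrow> bool" where
  "eta_factorizable_on M f \<longleftrightarrow>
     (\<exists>g h. holomorphic_eta_quotient_on M g \<and> \<not> g constant_on {z. Im z > 0} \<and>
            holomorphic_eta_quotient_on M h \<and> \<not> h constant_on {z. Im z > 0} \<and>
            f = (\<lambda>z. g z * h z))"

definition rad :: "nat \<Rightarrow> nat" where
  "rad N = \<Prod>(prime_factors N)"

definition kappa :: "nat \<Rightarrow> nat" where
  "kappa N = totient (rad N) *
     (\<Prod>p\<in>prime_factors N. (multiplicity p N - 1) * (p - 1) + 2)"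

end

theory Submission
  imports Defs "HOL-Real_Asymp.Real_Asymp"
begin

text \<open>
  The function \<open>Im z \<bar>\<eta>(z)\<bar>^4\<close> is invariant under \<open>SL_2(\<int>)\<close>. For \<open>z \<mapsto> -1/z\<close> it suffices, by analytic
  continuation, to work on the imaginary axis; there the logarithmic derivative of \<open>\<eta>\<close> is a conditionally
  convergent sum of \<open>(m^2 y^2 - k^2) / (m^2 y^2 + k^2)^2\<close>, the inversion interchanges the two summations, and
  the defect of the interchange is the logarithmic derivative of the factor \<open>sqrt y\<close>.

  Invariance gives the order of an eta quotient at every cusp up to a bounded error, so an eta quotient on
  \<open>\<Gamma>_0(N)\<close> is holomorphic iff the linear forms \<open>\<Sum>d. gcd(t, d)^2 / d * X_d\<close>, \<open>t\<close> dividing \<open>N\<close>, are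
  nonnegative. Their matrix is an invertible Kronecker product over the primes dividing \<open>N\<close>, so the cone
  of holomorphic exponents is simplicial. Let \<open>v_t\<close> be the primitive vector on the ray where all forms but
  the one at \<open>t\<close> vanish. It is irreducible, and an irreducible eta quotient has at every \<open>t\<close> at most the
  order of \<open>v_t\<close>, since otherwise \<open>v_t\<close> splits off. Hence \<open>F\<close> is the product of the eta quotients of all
  \<open>v_t\<close>, and its weight is computed prime by prime.
\<close>

section \<open>Partial fractions\<close>

text \<open>The conditionally convergent sum is the weight 2 Eisenstein series in disguise, and its
  failure to be modular is what produces the weight 1/2 of eta. Beyond the inversion formula only
  absolute values of eta occur: this disposes of the 24th roots of unity in the transformation law
  and of every branch of a root, and it is all that the definition of a pole at a cusp sees. Once ln
  |f| is known at a cusp up to a bounded error, its linear growth in Im z gives the order; the same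
  estimate, applied to a constant f, shows that an eta quotient determines its exponents. A
  simplicial cone alone would not make v_t irreducible: some lattice vector on its ray might be a
  proper fraction of v_t. Primitivity is therefore carried along as data, an integral functional u_t
  with value 1 on v_t, which forces every lattice vector on the ray to be an integral multiple of
  v_t. These functionals, like all other requirements on the rays, multiply along coprime factors,
  so explicit vectors are needed for prime powers only.\<close>

lemma infsum_eq_suminf_of_summable_norm:
  fixes f :: "nat \<Rightarrow> real"
  assumes "summable (\<lambda>n. norm (f n))"
  shows "infsum f UNIV = suminf f"
  by (intro infsumI norm_summable_imp_has_sum[OF assms] summable_sums summable_norm_cancel[OF assms])

text \<open>A product majorant gives absolute summability over all pairs and also dominates each row
  and each column, so the iterated sums exist in both orders and Fubini applies.\<close>

lemma suminf_swap_of_product_bound: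
  fixes f :: "nat \<Rightarrow> nat \<Rightarrow> real"
  assumes bound: "\<And>m k. \<bar>f m k\<bar> \<le> g m * h k" and g: "summable g" and h: "summable h"
    and g0: "\<And>m. g m \<ge> 0" and h0: "\<And>m. h m \<ge> 0"
  shows "summable (f m)" and "summable (\<lambda>m. f m k)"
    and "summable (\<lambda>m. \<Sum>k. f m k)" and "summable (\<lambda>k. \<Sum>m. f m k)"
    and "(\<Sum>m. \<Sum>k. f m k) = (\<Sum>k. \<Sum>m. f m k)"
proof -
  have row: "summable (\<lambda>k. norm (f m k))" for m
    by (rule summable_comparison_test'[OF summable_mult[OF h, of "g m"]]) (use bound in auto)
  have col: "summable (\<lambda>m. norm (f m k))" for k
    by (rule summable_comparison_test'[OF summable_mult2[OF g, of "h k"]]) (use bound in auto)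
  show "summable (f m)" "summable (\<lambda>m. f m k)" for m k
    by (rule summable_norm_cancel[OF row], rule summable_norm_cancel[OF col])
  have gh: "(\<lambda>(m, k). g m * h k) summable_on UNIV \<times> UNIV"
  proof (rule summable_on_SigmaI)
    show "((\<lambda>k. case (m, k) of (m, k) \<Rightarrow> g m * h k) has_sum g m * suminf h) UNIV" for m
      using g0 h0 h by (auto intro!: has_sum_cmult_right norm_summable_imp_has_sum summable_sums)
    show "(\<lambda>m. g m * suminf h) summable_on UNIV"
      using g0 g by (intro summable_on_cmult_left summable_nonneg_imp_summable_on)
  qed (use g0 h0 in auto)
  have f: "(\<lambda>(m, k). f m k) summable_on UNIV \<times> UNIV"
  proof (rule abs_summable_summable, rule summable_on_comparison_test[OF gh])
    show "norm (case p of (m, k) \<Rightarrow> f m k) \<le> (case p of (m, k) \<Rightarrow> g m * h k)" for p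
      using bound by (auto simp: case_prod_unfold)
  qed auto
  have row_infsum: "infsum (f m) UNIV = (\<Sum>k. f m k)" for m
    by (rule infsum_eq_suminf_of_summable_norm[OF row])
  have col_infsum: "infsum (\<lambda>m. f m k) UNIV = (\<Sum>m. f m k)" for k
    by (rule infsum_eq_suminf_of_summable_norm[OF col])
  have row_bound: "norm (\<Sum>k. f m k) \<le> g m * suminf h" for m
  proof -
    have "norm (\<Sum>k. f m k) \<le> (\<Sum>k. norm (f m k))" by (rule summable_norm[OF row])
    also have "\<dots> \<le> (\<Sum>k. g m * h k)"
      by (rule suminf_le) (use bound row summable_mult[OF h] in auto)
    finally show ?thesis by (simp add: suminf_mult[OF h])
  qed
  have col_bound: "norm (\<Sum>m. f m k) \<le> suminf g * h k" for k
  proof -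
    have "norm (\<Sum>m. f m k) \<le> (\<Sum>m. norm (f m k))" by (rule summable_norm[OF col])
    also have "\<dots> \<le> (\<Sum>m. g m * h k)"
      by (rule suminf_le) (use bound col summable_mult2[OF g] in auto)
    finally show ?thesis by (simp add: suminf_mult2[OF g])
  qed
  have rows: "summable (\<lambda>m. norm (\<Sum>k. f m k))"
    by (rule summable_comparison_test'[OF summable_mult2[OF g, of "suminf h"]]) (use row_bound in auto)
  have cols: "summable (\<lambda>k. norm (\<Sum>m. f m k))"
    by (rule summable_comparison_test'[OF summable_mult[OF h, of "suminf g"]]) (use col_bound in auto)
  show "summable (\<lambda>m. \<Sum>k. f m k)" "summable (\<lambda>k. \<Sum>m. f m k)"
    by (rule summable_norm_cancel[OF rows], rule summable_norm_cancel[OF cols])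
  have "(\<Sum>m. \<Sum>k. f m k) = infsum (\<lambda>m. infsum (f m) UNIV) UNIV"
    unfolding row_infsum by (rule infsum_eq_suminf_of_summable_norm[OF rows, symmetric])
  also have "\<dots> = infsum (\<lambda>k. infsum (\<lambda>m. f m k) UNIV) UNIV"
    by (rule infsum_swap_banach[OF f])
  also have "\<dots> = (\<Sum>k. \<Sum>m. f m k)"
    unfolding col_infsum by (rule infsum_eq_suminf_of_summable_norm[OF cols])
  finally show "(\<Sum>m. \<Sum>k. f m k) = (\<Sum>k. \<Sum>m. f m k)" .
qed

text \<open>By the reflection formula \<open>Gamma w * Gamma (1 - w) * sin (pi * w)\<close> is
  constant near z, so its logarithmic derivative vanishes.\<close>

lemma Digamma_reflection:
  fixes z :: complex
  assumes "z \<notin> \<int>"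
  shows "Digamma z - Digamma (1 - z) = - of_real pi * cot (of_real pi * z)"
proof -
  have ev: "\<forall>\<^sub>F w in nhds z. Gamma w * Gamma (1 - w) * sin (of_real pi * w) = of_real pi"
  proof -
    have "open (- (\<int> :: complex set))" by (intro open_Compl closed_Ints)
    then have "\<forall>\<^sub>F w in nhds z. w \<in> - \<int>" using assms by (intro eventually_nhds_in_open) auto
    then show ?thesis
    proof eventually_elim
      case (elim w)
      then have "sin (of_real pi * w) \<noteq> 0" by (auto simp: sin_eq_0)
      then show ?case using Gamma_reflection_complex[of w] by (simp add: field_simps)
    qed
  qed
  have nz: "z \<notin> \<int>\<^sub>\<le>\<^sub>0" "1 - z \<notin> \<int>\<^sub>\<le>\<^sub>0"
    using assms nonpos_Ints_Int Ints_diff[OF Ints_1, of "1 - z"] by auto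
  have s: "sin (of_real pi * z) \<noteq> 0" using assms by (auto simp: sin_eq_0)
  have g: "Gamma z \<noteq> 0" "Gamma (1 - z) \<noteq> 0" using nz by (auto simp: Gamma_eq_zero_iff)
  have "((\<lambda>w. Gamma w * Gamma (1 - w) * sin (of_real pi * w)) has_field_derivative
     Gamma z * Gamma (1 - z) * ((Digamma z - Digamma (1 - z)) * sin (of_real pi * z) + of_real pi * cos (of_real pi * z))) (at z)"
    using nz by (auto intro!: derivative_eq_intros simp: algebra_simps)
  moreover have "((\<lambda>w. Gamma w * Gamma (1 - w) * sin (of_real pi * w)) has_field_derivative 0) (at z)"
    by (subst DERIV_cong_ev[OF refl ev refl]) auto
  ultimately have "Gamma z * Gamma (1 - z) * ((Digamma z - Digamma (1 - z)) * sin (of_real pi * z) + of_real pi * cos (of_real pi * z)) = 0"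
    by (rule DERIV_unique)
  then have "(Digamma z - Digamma (1 - z)) * sin (of_real pi * z) + of_real pi * cos (of_real pi * z) = 0"
    using g by simp
  then show ?thesis using s by (simp add: cot_def field_simps add_eq_0_iff)
qed

text \<open>The derivative of \<open>Digamma_reflection\<close>. As \<open>Polygamma 1 z\<close> is
  the series of \<open>1 / (z + k)^2\<close>, this is the partial fraction expansion of pi^2 /
  sin^2.\<close>

lemma trigamma_reflection:
  fixes z :: complex
  assumes "z \<notin> \<int>"
  shows "Polygamma 1 z + Polygamma 1 (1 - z) = of_real pi ^ 2 / sin (of_real pi * z) ^ 2"
proof -
  have ev: "\<forall>\<^sub>F w in nhds z. Digamma w - Digamma (1 - w) = - of_real pi * cot (of_real pi * w)"
  proof -
    have "open (- (\<int> :: complex set))" by (intro open_Compl closed_Ints)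
    then have "\<forall>\<^sub>F w in nhds z. w \<in> - \<int>" using assms by (intro eventually_nhds_in_open) auto
    then show ?thesis by eventually_elim (simp only: Digamma_reflection Compl_iff not_False_eq_True)
  qed
  have nz: "z \<notin> \<int>\<^sub>\<le>\<^sub>0" "1 - z \<notin> \<int>\<^sub>\<le>\<^sub>0"
    using assms nonpos_Ints_Int Ints_diff[OF Ints_1, of "1 - z"] by auto
  have s: "sin (of_real pi * z) \<noteq> 0" using assms by (auto simp: sin_eq_0)
  have "((\<lambda>w. Digamma w - Digamma (1 - w)) has_field_derivative Polygamma 1 z + Polygamma 1 (1 - z)) (at z)"
    using nz by (auto intro!: derivative_eq_intros)
  moreover have "((\<lambda>w. - of_real pi * cot (of_real pi * w)) has_field_derivative of_real pi ^ 2 / sin (of_real pi * z) ^ 2) (at z)"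
    using DERIV_cmult[OF DERIV_chain2[OF DERIV_cot[OF s] DERIV_cmult_Id], of "- of_real pi"]
    by (simp add: power2_eq_square field_simps)
  ultimately show ?thesis
    using DERIV_cong_ev[OF refl ev refl] DERIV_unique by metis
qed

text \<open>The real part of 1 / (a + i b)^2. With a = m y and b = k it is, up to sign, the real
  part of the summand 1 / (m z + k)^2 of the weight 2 Eisenstein series at z = i y.\<close>

definition lattice_term :: "real \<Rightarrow> real \<Rightarrow> real" where
  "lattice_term a b = (a^2 - b^2) / (a^2 + b^2)^2"

lemma lattice_term_swap: "lattice_term b a = - lattice_term a b"
  by (simp add: lattice_term_def add.commute minus_divide_left)

lemma lattice_term_scale: "c \<noteq> 0 \<Longrightarrow> lattice_term (c * a) (c * b) = lattice_term a b / c^2"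
  unfolding lattice_term_def power_mult_distrib distrib_left[symmetric] right_diff_distrib[symmetric]
  by (simp add: power2_eq_square)

lemma Re_inverse_square_add_ii: "Re (inverse ((\<i> * of_real x + of_real k)^2)) = - lattice_term x k"
  by (simp add: lattice_term_def power2_eq_square Re_divide inverse_eq_divide complex_eq_iff algebra_simps minus_divide_left)

text \<open>The trigamma reflection at z = i x, where the sine becomes i times a hyperbolic
  sine.\<close>

lemma sums_lattice_term:
  assumes "x > 0"
  shows "(\<lambda>k. lattice_term x (real (Suc k))) sums ((pi^2 / sinh (pi * x)^2 - 1 / x^2) / 2)"
proof -
  define z where "z = \<i> * complex_of_real x"
  have nI: "z \<notin> \<int>"
    using assms by (auto simp: z_def Ints_def complex_eq_iff)
  have z0: "z \<noteq> 0" "1 - z \<noteq> 0" using assms by (auto simp: z_def complex_eq_iff)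
  have 1: "(\<lambda>k. inverse ((z + of_nat k)^2)) sums Polygamma 1 z"
    using Polygamma_LIMSEQ[OF z0(1), of 1] by (simp add: numeral_2_eq_2)
  have 2: "(\<lambda>k. inverse (((1 - z) + of_nat k)^2)) sums Polygamma 1 (1 - z)"
    using Polygamma_LIMSEQ[OF z0(2), of 1] by (simp add: numeral_2_eq_2)
  \<comment> \<open>Dropping the term k = 0 aligns the two series: the k-th terms now belong to z +
    (k + 1) and -z + (k + 1), which have the same real part. The dropped term accounts for
    \<open>1 / x^2\<close>.\<close>
  have 3: "(\<lambda>k. inverse ((z + of_nat (Suc k))^2)) sums (Polygamma 1 z - inverse (z^2))"
    using sums_Suc_iff[of "\<lambda>k. inverse ((z + of_nat k)^2)"] 1 by simp
  have "(\<lambda>k. Re (inverse ((z + of_nat (Suc k))^2) + inverse (((1 - z) + of_nat k)^2)))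
     sums Re ((Polygamma 1 z - inverse (z^2)) + Polygamma 1 (1 - z))"
    by (rule sums_Re[OF sums_add[OF 3 2]])
  moreover have "Re (inverse ((z + of_nat (Suc k))^2) + inverse (((1 - z) + of_nat k)^2))
    = - 2 * lattice_term x (real (Suc k))" for k
  proof -
    have "(1 - z) + of_nat k = \<i> * of_real (-x) + of_real (real (Suc k))" by (simp add: z_def)
    moreover have "z + of_nat (Suc k) = \<i> * of_real x + of_real (real (Suc k))" by (simp add: z_def)
    moreover have "lattice_term (-x) k' = lattice_term x k'" for k' by (simp add: lattice_term_def)
    ultimately show ?thesis by (simp only: Re_inverse_square_add_ii plus_complex.simps)
  qed
  moreover have "Polygamma 1 z - inverse (z^2) + Polygamma 1 (1 - z) = - of_real (pi^2 / sinh (pi * x)^2 - 1/x^2)"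
  proof -
    have "sin (of_real pi * z) = \<i> * of_real (sinh (pi * x))"
      unfolding z_def sin_exp_eq sinh_field_def
      by (simp add: exp_of_real[symmetric] field_simps)
    then have "Polygamma 1 z + Polygamma 1 (1 - z) = - of_real (pi^2 / sinh (pi * x)^2)"
      using trigamma_reflection[OF nI] by (simp add: power_mult_distrib)
    moreover have "inverse (z^2) = - of_real (1/x^2)"
      by (simp add: z_def power_mult_distrib inverse_eq_divide)
    ultimately show ?thesis
      by (simp only: add_diff_eq diff_add_eq of_real_diff) (simp only: minus_diff_eq minus_minus uminus_add_conv_diff diff_minus_eq_add)
  qed
  ultimately have "(\<lambda>k. - 2 * lattice_term x (real (Suc k))) sums (- (pi^2 / sinh (pi * x)^2 - 1/x^2))"
    by (simp only: uminus_complex.simps Re_complex_of_real)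
  from sums_mult[OF this, of "-1/2"] show ?thesis by (simp add: diff_divide_distrib)
qed

section \<open>A conditionally convergent lattice sum\<close>

definition lattice_primitive :: "real \<Rightarrow> real \<Rightarrow> real" where
  "lattice_primitive a b = b / (a^2 + b^2)"

text \<open>Over the common denominator \<open>D^2 * E\<close> the terms of degree four in the
  numerator cancel. The cubic remainder is at most \<open>3 * k * D\<close>, which cancels one
  factor D.\<close>

lemma lattice_term_minus_difference:
  assumes "a > 0" "k \<ge> 1"
  shows "\<bar>lattice_term a k - (lattice_primitive a k - lattice_primitive a (k - 1))\<bar>
    \<le> 3 * k / ((a^2 + k^2) * (a^2 + (k - 1)^2))"
proof -
  define D E where "D = a^2 + k^2" and "E = a^2 + (k - 1)^2"
  have pos: "D > 0" "E > 0" using assms by (auto simp: D_def E_def add_pos_nonneg)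
  have "lattice_term a k - (lattice_primitive a k - lattice_primitive a (k - 1))
      = (a^2 * (1 - 3 * k) + k^2 * (k - 1)) / (D^2 * E)"
  proof -
    have "lattice_term a k - (lattice_primitive a k - lattice_primitive a (k - 1))
      = ((a^2 - k^2) * E - (k * E - (k - 1) * D) * D) / (D^2 * E)"
      using pos unfolding lattice_term_def lattice_primitive_def D_def[symmetric] E_def[symmetric]
      by (simp add: field_simps power2_eq_square)
    also have "(a^2 - k^2) * E - (k * E - (k - 1) * D) * D = a^2 * (1 - 3 * k) + k^2 * (k - 1)"
      unfolding D_def E_def by (simp add: power2_eq_square algebra_simps)
    finally show ?thesis .
  qed
  also have "\<bar>\<dots>\<bar> \<le> (3 * k * D) / (D^2 * E)"
  proof -
    have "\<bar>a^2 * (1 - 3 * k) + k^2 * (k - 1)\<bar> \<le> \<bar>a^2 * (1 - 3 * k)\<bar> + \<bar>k^2 * (k - 1)\<bar>"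
      by (rule abs_triangle_ineq)
    also have "\<dots> = a^2 * (3 * k - 1) + k^2 * (k - 1)" using assms by (simp add: abs_mult)
    also have "\<dots> \<le> a^2 * (3 * k) + k^2 * (3 * k)" using assms
      by (intro add_mono mult_left_mono) auto
    also have "\<dots> = 3 * k * D" by (simp add: D_def algebra_simps)
    finally show ?thesis using pos by (simp add: abs_mult divide_right_mono)
  qed
  also have "\<dots> = 3 * k / (D * E)" using pos by (simp add: power2_eq_square)
  finally show ?thesis by (simp add: D_def E_def)
qed

text \<open>Puts the previous bound into the product form needed for interchanging sums. The
  quotient is of size x / D^2, and D^2 = D^(3/4) D^(5/4) is split unevenly so that, after the
  numerator x is used up, both variables keep the summable exponent -3/2.\<close>

lemma lattice_term_minus_difference_powr:
  assumes "y > 0" "a \<ge> y"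
  shows "\<bar>lattice_term a (real (Suc k)) - (lattice_primitive a (real (Suc k)) - lattice_primitive a (real k))\<bar>
    \<le> 12 * (1 + y^2) / y^2 * (a powr (-3/2) * real (Suc k) powr (-3/2))"
proof -
  define x where "x = real (Suc k)"
  define D E where "D = a^2 + x^2" and "E = a^2 + (x - 1)^2"
  have x: "x \<ge> 1" and a: "a > 0" using assms by (auto simp: x_def)
  have pos: "D > 0" "E > 0" using x a by (auto simp: D_def E_def add_pos_nonneg)
  have ya: "y^2 \<le> a^2" using assms by (intro power_mono) auto
  \<comment> \<open>E is comparable to D. For k > 0 this follows from
    \<open>x \<le> 2 * (x - 1)\<close>; for k = 0, E degenerates to a^2, and only
    \<open>a \<ge> y\<close> keeps it away from 0. Hence the constant depends on y, and 12 is 3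
    times the 4 found here.\<close>
  have E: "y^2 * D \<le> 4 * (1 + y^2) * E"
  proof (cases k)
    case 0
    then have "x = 1" by (simp add: x_def)
    then have "y^2 * D = y^2 * a^2 + y^2" "4 * (1 + y^2) * E = 4 * a^2 + 4 * (y^2 * a^2)"
      by (simp_all add: D_def E_def algebra_simps)
    moreover have "0 \<le> y^2 * a^2" "0 \<le> a^2" by simp_all
    ultimately show ?thesis using ya by linarith
  next
    case (Suc j)
    then have "x \<le> 2 * (x - 1)" by (simp add: x_def)
    then have "x^2 \<le> (2 * (x - 1))^2" using x by (intro power_mono) auto
    then have "x^2 \<le> 4 * (x - 1)^2" by (simp only: power_mult_distrib) simp
    moreover have "0 \<le> a^2" by simp
    ultimately have "D \<le> 4 * E" unfolding D_def E_def by (simp only: distrib_left)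
    then have "y^2 * D \<le> y^2 * (4 * E)" by (rule mult_left_mono) simp
    also have "\<dots> \<le> 4 * (1 + y^2) * E" using pos by (simp add: algebra_simps)
    finally show ?thesis .
  qed
  have D2: "a powr (3/2) * x powr (5/2) \<le> D^2"
  proof -
    have "a powr (3/2) = (a^2) powr (3/4)" "x powr (5/2) = (x^2) powr (5/4)"
      using a x by (simp_all add: powr_powr flip: powr_numeral)
    moreover have "(a^2) powr (3/4) * (x^2) powr (5/4) \<le> D powr (3/4) * D powr (5/4)"
      by (intro mult_mono powr_mono2) (auto simp: D_def)
    moreover have "D powr (3/4) * D powr (5/4) = D^2"
      using pos by (simp add: powr_add[symmetric])
    ultimately show ?thesis by simp
  qed
  have x52: "x powr (5/2) = x * x powr (3/2)"
    using x powr_mult_base[of x "3/2"] by simp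
  have "\<bar>lattice_term a x - (lattice_primitive a x - lattice_primitive a (x - 1))\<bar> \<le> 3 * x / (D * E)"
    unfolding D_def E_def by (rule lattice_term_minus_difference[OF a x])
  also have "\<dots> \<le> 3 * x * (4 * (1 + y^2) / y^2) / D^2"
  proof -
    have "1 / E \<le> (4 * (1 + y^2) / y^2) / D" using E pos assms by (simp add: field_simps)
    then have "(3 * x / D) * (1 / E) \<le> (3 * x / D) * ((4 * (1 + y^2) / y^2) / D)"
      using x pos by (intro mult_left_mono) auto
    then show ?thesis by (simp add: power2_eq_square mult_ac)
  qed
  also have "\<dots> \<le> 3 * x * (4 * (1 + y^2) / y^2) / (a powr (3/2) * x powr (5/2))"
    using D2 x a pos assms by (intro divide_left_mono) auto
  also have "\<dots> = 12 * (1 + y^2) / y^2 * (1 / a powr (3/2) * (1 / x powr (3/2)))"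
    unfolding x52 using x by simp
  also have "\<dots> = 12 * (1 + y^2) / y^2 * (a powr (-3/2) * x powr (-3/2))"
    by (simp add: powr_minus_divide)
  finally show ?thesis by (simp add: x_def)
qed

lemma arctan_difference_bounds:
  assumes "0 \<le> p" "p < q"
  shows "(q - p) / (1 + q^2) \<le> arctan q - arctan p" "arctan q - arctan p \<le> (q - p) / (1 + p^2)"
proof -
  obtain z where z: "z > p" "z < q" "arctan q - arctan p = (q - p) * inverse (1 + z^2)"
    using MVT2[OF assms(2), of arctan "\<lambda>x. inverse (1 + x^2)"] DERIV_arctan by blast
  have "z^2 \<le> q^2" "p^2 \<le> z^2" using z assms by (auto intro!: power_mono)
  then have "inverse (1 + q^2) \<le> inverse (1 + z^2)" "inverse (1 + z^2) \<le> inverse (1 + p^2)"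
    by (auto intro!: le_imp_inverse_le simp: add_pos_nonneg)
  then show "(q - p) / (1 + q^2) \<le> arctan q - arctan p" "arctan q - arctan p \<le> (q - p) / (1 + p^2)"
    unfolding z(3) divide_inverse using assms by (auto intro!: mult_left_mono)
qed

text \<open>Multiplied by y, the series is a Riemann sum with step y / k for the integral of 1 / (1
  + x^2) over the positive axis, so differences of arctan enclose every term. As the sum starts at
  the first node after 0, the lower bound loses the first interval, that is,
  \<open>arctan (y / k)\<close>.\<close>

lemma suminf_lattice_primitive_bounds:
  assumes "y > 0" "k > 0"
  shows "summable (\<lambda>m. lattice_primitive (real (Suc m) * y) k)"
    and "(\<Sum>m. lattice_primitive (real (Suc m) * y) k) \<le> pi / (2 * y)"
    and "pi / (2 * y) - arctan (y / k) / y \<le> (\<Sum>m. lattice_primitive (real (Suc m) * y) k)"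
proof -
  define u where "u m = arctan (real m * y / k)" for m
  define f where "f m = lattice_primitive (real (Suc m) * y) k" for m
  have "filterlim (\<lambda>m. real m * (y / k)) at_top sequentially"
    using assms by (intro filterlim_at_top_mult_tendsto_pos[OF tendsto_const] filterlim_real_sequentially) auto
  then have u: "u \<longlonglongrightarrow> pi / 2"
    unfolding u_def using filterlim_compose[OF tendsto_arctan_at_top] by fastforce
  have upper: "y * f m \<le> u (Suc m) - u m" and lower: "u (Suc (Suc m)) - u (Suc m) \<le> y * f m" for m
  proof -
    have f: "y * f m = (y / k) / (1 + (real (Suc m) * y / k)^2)"
      using assms by (simp add: f_def lattice_primitive_def field_simps power2_eq_square)
    have *: "real (Suc m) * y / k - real m * y / k = y / k" for m
      by (simp add: algebra_simps add_divide_distrib)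
    have **: "real m * y / k < real (Suc m) * y / k" for m
      using assms by (intro divide_strict_right_mono mult_strict_right_mono) auto
    show "y * f m \<le> u (Suc m) - u m"
      using arctan_difference_bounds(1)[OF _ **[of m]] assms unfolding u_def f * by auto
    show "u (Suc (Suc m)) - u (Suc m) \<le> y * f m"
      using arctan_difference_bounds(2)[OF _ **[of "Suc m"]] assms unfolding u_def f * by auto
  qed
  have s1: "(\<lambda>m. u (Suc m) - u m) sums (pi / 2)"
    using telescope_sums[OF u] by (simp add: u_def)
  have s2: "(\<lambda>m. u (Suc (Suc m)) - u (Suc m)) sums (pi / 2 - arctan (y / k))"
    using telescope_sums[OF LIMSEQ_Suc[OF u]] by (simp add: u_def)
  have f0: "f m \<ge> 0" for m using assms by (auto simp: f_def lattice_primitive_def)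
  have yf: "summable (\<lambda>m. y * f m)"
    by (rule summable_comparison_test'[OF sums_summable[OF s1]]) (use upper f0 assms in auto)
  then show f: "summable (\<lambda>m. lattice_primitive (real (Suc m) * y) k)"
    using assms by (simp add: f_def)
  have eq: "(\<Sum>m. y * f m) = y * suminf f"
    by (rule suminf_mult) (use f in \<open>simp only: f_def\<close>)
  have "y * suminf f \<le> pi / 2"
    using suminf_le[OF upper yf sums_summable[OF s1]] sums_unique[OF s1] eq by simp
  then show "(\<Sum>m. lattice_primitive (real (Suc m) * y) k) \<le> pi / (2 * y)"
    using assms unfolding f_def[symmetric] by (simp add: field_simps)
  have "pi / 2 - arctan (y / k) \<le> y * suminf f"
    using suminf_le[OF lower sums_summable[OF s2] yf] sums_unique[OF s2] eq by simp
  then show "pi / (2 * y) - arctan (y / k) / y \<le> (\<Sum>m. lattice_primitive (real (Suc m) * y) k)"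
    using assms unfolding f_def[symmetric] by (simp add: field_simps)
qed

text \<open>Every single summand tends to 0 as k grows, but the sum does not. This escape of mass is
  the origin of the factor sqrt y in the inversion of eta.\<close>

lemma suminf_lattice_primitive_tendsto:
  assumes "y > 0"
  shows "(\<lambda>k. \<Sum>m. lattice_primitive (real (Suc m) * y) (real k)) \<longlonglongrightarrow> pi / (2 * y)"
proof (rule tendsto_sandwich[OF _ _ _ tendsto_const])
  have "(\<lambda>k. y / real k) \<longlonglongrightarrow> 0" by (rule lim_const_over_n)
  then have "(\<lambda>k. pi / (2 * y) - arctan (y / real k) / y) \<longlonglongrightarrow> pi / (2 * y) - arctan 0 / y"
    by (intro tendsto_intros) (use assms in auto)
  then show "(\<lambda>k. pi / (2 * y) - arctan (y / real k) / y) \<longlonglongrightarrow> pi / (2 * y)" by simp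
  show "\<forall>\<^sub>F k in sequentially. pi / (2 * y) - arctan (y / real k) / y \<le> (\<Sum>m. lattice_primitive (real (Suc m) * y) (real k))"
    using eventually_gt_at_top[of 0] by eventually_elim (use assms in \<open>simp only: suminf_lattice_primitive_bounds of_nat_0_less_iff\<close>)
  show "\<forall>\<^sub>F k in sequentially. (\<Sum>m. lattice_primitive (real (Suc m) * y) (real k)) \<le> pi / (2 * y)"
    using eventually_gt_at_top[of 0] by eventually_elim (use assms in \<open>simp only: suminf_lattice_primitive_bounds of_nat_0_less_iff\<close>)
qed

text \<open>The double series converges only conditionally. Subtracting the differences of
  \<open>lattice_primitive\<close> in \<open>k\<close>, a primitive of \<open>lattice_term\<close> in its second argument, makes it
  absolutely convergent, so the two orders of summation differ by what the telescoping part contributes.\<close>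

lemma lattice_sum_swap:
  assumes y: "y > 0"
  defines "f \<equiv> (\<lambda>m k. lattice_term (real (Suc m) * y) (real (Suc k)))"
  shows "summable (\<lambda>m. \<Sum>k. f m k)" and "summable (\<lambda>k. \<Sum>m. f m k)"
    and "(\<Sum>k. \<Sum>m. f m k) = (\<Sum>m. \<Sum>k. f m k) + pi / (2 * y)"
proof -
  define t where "t m k = lattice_primitive (real (Suc m) * y) (real k)" for m k
  define r where "r m k = f m k - (t m (Suc k) - t m k)" for m k
  define g where "g m = 12 * (1 + y^2) / y^2 * (real (Suc m) * y) powr (-3/2)" for m
  define h where "h k = real (Suc k) powr (-3/2)" for k
  have bound: "\<bar>r m k\<bar> \<le> g m * h k" for m k
    using lattice_term_minus_difference_powr[OF y, of "real (Suc m) * y" k] y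
    by (simp add: r_def f_def t_def g_def h_def)
  have h: "summable h"
    unfolding h_def using summable_Suc_iff[of "\<lambda>n. real n powr (-3/2)"]
    by (simp add: summable_real_powr_iff del: of_nat_Suc)
  have "summable (\<lambda>m. 12 * (1 + y^2) / y^2 * y powr (-3/2) * h m)"
    by (rule summable_mult[OF h])
  then have g: "summable g"
    unfolding g_def h_def using y by (subst powr_mult) (auto simp: mult_ac)
  have nn: "g m \<ge> 0" "h m \<ge> 0" for m by (auto simp: g_def h_def)
  note r = suminf_swap_of_product_bound[of r, OF bound g h nn]
  \<comment> \<open>Along a row the telescoping part runs from 0 to 0 and contributes nothing,
    whereas its column sums \<open>T\<close> run from 0 to \<open>pi / (2 * y)\<close>. This is the
    whole asymmetry between the two orders of summation.\<close>
  have row: "(\<lambda>k. t m (Suc k) - t m k) sums 0" for m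
  proof -
    have "(\<lambda>k. t m k) \<longlonglongrightarrow> 0"
    proof (rule tendsto_sandwich[OF _ _ tendsto_const lim_1_over_n])
      show "\<forall>\<^sub>F k in sequentially. t m k \<le> 1 / real k"
        using eventually_gt_at_top[of 0]
      proof eventually_elim
        case (elim k)
        then have "t m k \<le> real k / (real k)^2"
          unfolding t_def lattice_primitive_def
          by (intro divide_left_mono mult_pos_pos add_nonneg_pos) auto
        then show ?case using elim by (simp add: power2_eq_square)
      qed
    qed (auto simp: t_def lattice_primitive_def)
    from telescope_sums[OF this] show ?thesis by (simp add: t_def lattice_primitive_def)
  qed
  have tsum: "summable (\<lambda>m. t m k)" for k
    using suminf_lattice_primitive_bounds(1)[OF y, of "real k"] 
    by (cases "k = 0") (auto simp: t_def lattice_primitive_def)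
  have f: "f m k = r m k + (t m (Suc k) - t m k)" for m k by (simp add: r_def)
  have rowsum: "(\<Sum>k. f m k) = (\<Sum>k. r m k)" for m
    unfolding f using suminf_add[OF r(1)[of m] sums_summable[OF row[of m]]] sums_unique[OF row[of m]] by simp
  define T where "T k = (\<Sum>m. t m k)" for k
  have colsum: "(\<Sum>m. f m k) = (\<Sum>m. r m k) + (T (Suc k) - T k)" for k
    unfolding f T_def suminf_diff[OF tsum tsum]
    by (rule suminf_add[symmetric] r summable_diff tsum)+
  have "T \<longlonglongrightarrow> pi / (2 * y)"
    unfolding T_def t_def by (rule suminf_lattice_primitive_tendsto[OF y])
  from telescope_sums[OF this] have T: "(\<lambda>k. T (Suc k) - T k) sums (pi / (2 * y))"
    by (simp add: T_def t_def lattice_primitive_def)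
  show "summable (\<lambda>m. \<Sum>k. f m k)" unfolding rowsum by (rule r)
  show "summable (\<lambda>k. \<Sum>m. f m k)" unfolding colsum by (intro summable_add r sums_summable[OF T])
  show "(\<Sum>k. \<Sum>m. f m k) = (\<Sum>m. \<Sum>k. f m k) + pi / (2 * y)"
    unfolding rowsum colsum using suminf_add[OF r(4) sums_summable[OF T]] sums_unique[OF T] r(5) by simp
qed

section \<open>The Lambert series of the logarithmic derivative of eta\<close>

text \<open>With q = exp(-2 pi y) this is 2 pi times the sum of n q^n / (1 - q^n), that is, (pi /
  12) (1 - E_2(i y)). It will turn out to be the derivative of \<open>ln_euler_prod\<close>.\<close>

definition lambert :: "real \<Rightarrow> real" where
  "lambert y = (\<Sum>n. 2 * pi * real (Suc n) / (exp (2 * pi * real (Suc n) * y) - 1))"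

text \<open>Both expressions are iterated sums of 2 pi n exp(-2 pi n m y): geometric series in m
  give \<open>lambert\<close>, differentiated geometric series in n give the 1 / sinh^2
  terms.\<close>

lemma sums_lambert:
  assumes y: "y > 0"
  shows "(\<lambda>m. (pi / 2) / sinh (pi * (real (Suc m) * y))^2) sums lambert y"
proof -
  define f where "f n m = 2 * pi * real (Suc n) * exp (- 2 * pi * real (Suc n) * real (Suc m) * y)" for n m
  define q where "q = exp (- pi * y)"
  have q: "q > 0" "q < 1" using y by (auto simp: q_def)
  define g where "g n = 2 * pi * q * (real (Suc n) * q ^ n)" for n
  define h where "h m = q * q ^ m" for m :: nat
  have g: "summable g"
    unfolding g_def using q by (intro summable_mult sums_summable[OF geometric_deriv_sums]) auto
  have h: "summable h"
    unfolding h_def using q by (intro summable_mult summable_geometric) auto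
  have nn: "g m \<ge> 0" "h m \<ge> 0" for m using q by (auto simp: g_def h_def)
  have bound: "\<bar>f n m\<bar> \<le> g n * h m" for n m
  proof -
    \<comment> \<open>From n + m \<le> 2 n m for positive n and m, the exponential is dominated by a
      product. Half of the decay is spent on this, so \<open>q\<close> is exp(-pi y) and not exp(-2
      pi y).\<close>
    have "real (Suc n) + real (Suc m) \<le> 2 * real (Suc n) * real (Suc m)"
      by (simp add: algebra_simps)
    then have "pi * y * (real (Suc n) + real (Suc m)) \<le> pi * y * (2 * real (Suc n) * real (Suc m))"
      using y by (intro mult_left_mono) auto
    then have "exp (- 2 * pi * real (Suc n) * real (Suc m) * y) \<le> exp (real (Suc n) * (- pi * y)) * exp (real (Suc m) * (- pi * y))"
      unfolding exp_add[symmetric] by (simp add: algebra_simps)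
    also have "\<dots> = q ^ Suc n * q ^ Suc m"
      unfolding q_def exp_of_nat_mult ..
    finally have "2 * pi * real (Suc n) * exp (- 2 * pi * real (Suc n) * real (Suc m) * y) \<le> 2 * pi * real (Suc n) * (q ^ Suc n * q ^ Suc m)"
      by (rule mult_left_mono) auto
    then show ?thesis by (simp add: f_def g_def h_def mult_ac abs_mult)
  qed
  note r = suminf_swap_of_product_bound[of f, OF bound g h nn]
  have row: "f n sums (2 * pi * real (Suc n) / (exp (2 * pi * real (Suc n) * y) - 1))" for n
  proof -
    define e where "e = exp (- (2 * pi * real (Suc n) * y))"
    have e: "e > 0" "e < 1" using y by (auto simp: e_def)
    have "(\<lambda>m. 2 * pi * real (Suc n) * e * e ^ m) sums (2 * pi * real (Suc n) * e * (1 / (1 - e)))"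
      using e by (intro sums_mult geometric_sums) auto
    moreover have "f n = (\<lambda>m. 2 * pi * real (Suc n) * e * e ^ m)"
    proof
      fix m
      have "e * e ^ m = exp (real (Suc m) * - (2 * pi * real (Suc n) * y))"
        unfolding e_def exp_of_nat_mult by simp
      also have "\<dots> = exp (- 2 * pi * real (Suc n) * real (Suc m) * y)" by (simp add: mult_ac)
      finally show "f n m = 2 * pi * real (Suc n) * e * e ^ m" by (simp only: f_def mult.assoc)
    qed
    moreover have e': "e * (1 / (1 - e)) = 1 / (exp (2 * pi * real (Suc n) * y) - 1)"
    proof -
      have "exp (2 * pi * real (Suc n) * y) = 1 / e" by (simp only: e_def exp_minus inverse_eq_divide) simp
      then show ?thesis using e by (simp only:) (simp add: divide_simps)
    qed
    ultimately have "f n sums (2 * pi * real (Suc n) * (e * (1 / (1 - e))))"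
      by (simp only: mult.assoc)
    then show ?thesis unfolding e' by simp
  qed
  have col: "(\<lambda>n. f n m) sums ((pi / 2) / sinh (pi * (real (Suc m) * y))^2)" for m
  proof -
    define w where "w = pi * (real (Suc m) * y)"
    define e where "e = exp (- (2 * w))"
    have w: "w > 0" using y by (simp add: w_def)
    then have e: "e > 0" "e < 1" by (auto simp: e_def)
    have "(\<lambda>n. 2 * pi * e * (real (Suc n) * e ^ n)) sums (2 * pi * e * (1 / (1 - e)^2))"
      using e by (intro sums_mult geometric_deriv_sums) auto
    moreover have "f n m = 2 * pi * e * (real (Suc n) * e ^ n)" for n
    proof -
      have "e * e ^ n = exp (real (Suc n) * - (2 * w))"
        unfolding e_def exp_of_nat_mult by simp
      also have "\<dots> = exp (- 2 * pi * real (Suc n) * real (Suc m) * y)" by (simp add: w_def algebra_simps)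
      finally show ?thesis by (simp add: f_def mult_ac)
    qed
    moreover have "2 * pi * e * (1 / (1 - e)^2) = (pi / 2) / sinh w^2"
    proof -
      define v where "v = exp (- w)"
      have v: "v > 0" "v < 1" using w by (auto simp: v_def)
      have e': "e = v^2" by (simp add: e_def v_def power2_eq_square flip: exp_add)
      have "sinh w = (1 / v - v) / 2" by (simp add: sinh_field_def v_def exp_minus field_simps)
      also have "\<dots> = (1 - v^2) / (2 * v)" using v by (simp add: field_simps power2_eq_square)
      finally have "sinh w ^ 2 = (1 - e)^2 / (4 * e)" by (simp add: e' power_divide power_mult_distrib)
      then show ?thesis by simp
    qed
    ultimately show ?thesis by (simp add: w_def)
  qed
  have "(\<lambda>m. \<Sum>n. f n m) sums (\<Sum>m. \<Sum>n. f n m)" using r(4) by (rule summable_sums)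
  moreover have "(\<Sum>m. \<Sum>n. f n m) = lambert y"
    unfolding r(5)[symmetric] lambert_def by (simp only: sums_unique[OF row, symmetric])
  ultimately show ?thesis by (simp only: sums_unique[OF col, symmetric])
qed

text \<open>Solving \<open>sums_lattice_term\<close> for 1 / sinh^2 and summing over m leaves the
  sum of 1 / (m y)^2; its value pi^2 / (6 y^2) is the origin of the term
  \<open>pi / (12 * y^2)\<close>.\<close>

lemma lambert_eq_lattice_sum:
  assumes y: "y > 0"
  shows "lambert y = pi / (12 * y^2) + (1 / pi) * (\<Sum>m. \<Sum>k. lattice_term (real (Suc m) * y) (real (Suc k)))"
proof -
  define S where "S m = (\<Sum>k. lattice_term (real (Suc m) * y) (real (Suc k)))" for m
  have S: "S m = (pi^2 / sinh (pi * (real (Suc m) * y))^2 - 1 / (real (Suc m) * y)^2) / 2" for m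
    unfolding S_def using y by (intro sums_unique[symmetric] sums_lattice_term) auto
  have "(\<lambda>m. 1 / (2 * pi * y^2) * (1 / real (Suc m)^2) + (1 / pi) * S m) sums
      (1 / (2 * pi * y^2) * (pi^2 / 6) + (1 / pi) * suminf S)"
    using lattice_sum_swap(1)[OF y] unfolding S_def
    by (intro sums_add sums_mult summable_sums) (use inverse_squares_sums in \<open>auto simp: add_ac\<close>)
  also have "(\<lambda>m. 1 / (2 * pi * y^2) * (1 / real (Suc m)^2) + (1 / pi) * S m) =
      (\<lambda>m. (pi / 2) / sinh (pi * (real (Suc m) * y))^2)"
    unfolding S using y by (auto simp: fun_eq_iff diff_divide_distrib right_diff_distrib power_mult_distrib power2_eq_square[of pi] mult_ac simp del: of_nat_Suc)
  finally have "lambert y = 1 / (2 * pi * y^2) * (pi^2 / 6) + (1 / pi) * suminf S"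
    using sums_lambert[OF y] sums_unique2 by blast
  then show ?thesis by (simp add: S_def[abs_def] power2_eq_square)
qed

text \<open>\<open>lattice_term\<close> is antisymmetric and homogeneous of degree -2, so replacing
  y by 1 / y exchanges m and k up to the factor \<open>- y^2\<close>. The quasi-modularity of E_2 on
  the imaginary axis is then \<open>lattice_sum_swap\<close>, whose defect becomes
  \<open>1 / (2 * y)\<close>.\<close>

lemma lambert_inversion:
  assumes y: "y > 0"
  shows "lambert y + lambert (1 / y) / y^2 = pi / (12 * y^2) + pi / 12 - 1 / (2 * y)"
proof -
  define A where "A = (\<Sum>m. \<Sum>k. lattice_term (real (Suc m) * y) (real (Suc k)))"
  define B where "B = (\<Sum>k. \<Sum>m. lattice_term (real (Suc m) * y) (real (Suc k)))"
  have B: "B = A + pi / (2 * y)" unfolding A_def B_def by (rule lattice_sum_swap(3)[OF y])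
  have inv: "lattice_term (real (Suc m) * (1 / y)) (real (Suc k)) = - (y^2) * lattice_term (real (Suc k) * y) (real (Suc m))" for m k
  proof -
    have "lattice_term (1 / y * real (Suc m)) (1 / y * (real (Suc k) * y)) = lattice_term (real (Suc m)) (real (Suc k) * y) / (1 / y)^2"
      using y by (intro lattice_term_scale) auto
    then show ?thesis
      using y by (subst lattice_term_swap) (simp add: power_divide mult_ac)
  qed
  have sm: "summable (\<lambda>m. lattice_term (real (Suc m) * y) (real (Suc k)))" for k
  proof -
    have "summable (\<lambda>m. lattice_term (real (Suc k) * (1 / y)) (real (Suc m)))"
      using y by (intro sums_summable[OF sums_lattice_term]) auto
    then show ?thesis unfolding inv by (subst (asm) summable_cmult_iff) (use y in auto)
  qed
  have "(\<Sum>m. \<Sum>k. lattice_term (real (Suc m) * (1 / y)) (real (Suc k))) = - (y^2) * B"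
    unfolding inv B_def suminf_mult[OF sm] by (rule suminf_mult[OF lattice_sum_swap(2)[OF y]])
  then have "lambert (1 / y) = pi * y^2 / 12 - (y^2) * B / pi"
    using lambert_eq_lattice_sum[of "1 / y"] y by (simp add: power_divide)
  moreover have "lambert y = pi / (12 * y^2) + A / pi"
    using lambert_eq_lattice_sum[OF y] by (simp add: A_def)
  moreover have "(pi * y^2 / 12 - y^2 * B / pi) / y^2 = pi / 12 - B / pi"
    using y by (simp add: diff_divide_distrib)
  ultimately show ?thesis using y by (simp add: B add_divide_distrib)
qed

section \<open>Transformation of the eta function\<close>

text \<open>Kept as a function of q on the full unit disc: its continuity at q = 0 describes eta
  near a cusp.\<close>

definition euler_prod :: "complex \<Rightarrow> complex" where
  "euler_prod q = (\<Prod>n. 1 - q ^ Suc n)"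

lemma dedekind_eta_eq:
  "dedekind_eta z = exp (2 * of_real pi * \<i> * z / 24) * euler_prod (exp (2 * of_real pi * \<i> * z))"
  by (simp add: dedekind_eta_def euler_prod_def)

lemma norm_exp_two_pi_ii: "norm (exp (2 * of_real pi * \<i> * z)) = exp (- 2 * pi * Im z)"
  by simp

lemma norm_exp_two_pi_ii_less_1: "Im z > 0 \<Longrightarrow> norm (exp (2 * of_real pi * \<i> * z)) < 1"
  by simp

lemma convergent_euler_prod:
  fixes q :: complex
  assumes "norm q < 1"
  shows "convergent_prod (\<lambda>n. 1 - q ^ Suc n)"
proof (rule abs_convergent_prod_imp_convergent_prod, rule summable_imp_abs_convergent_prod)
  have "summable (\<lambda>n. norm q * norm q ^ n)"
    using assms by (intro summable_mult summable_geometric) auto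
  then show "summable (\<lambda>n. norm (1 - q ^ Suc n - 1))" by (simp add: norm_mult norm_power)
qed

lemma power_Suc_neq_1:
  fixes q :: complex
  assumes "norm q < 1"
  shows "1 - q ^ Suc n \<noteq> 0"
proof
  assume "1 - q ^ Suc n = 0"
  then have "norm q ^ Suc n = 1" by (metis norm_one norm_power right_minus_eq)
  moreover have "norm q ^ Suc n \<le> norm q" using assms by (intro power_Suc_le_self) auto
  ultimately show False using assms by linarith
qed

lemma euler_prod_nonzero: "norm q < 1 \<Longrightarrow> euler_prod q \<noteq> 0"
  unfolding euler_prod_def by (intro prodinf_nonzero convergent_euler_prod power_Suc_neq_1)

lemma dedekind_eta_nonzero: "Im z > 0 \<Longrightarrow> dedekind_eta z \<noteq> 0"
  unfolding dedekind_eta_eq using euler_prod_nonzero[OF norm_exp_two_pi_ii_less_1, of z] by simp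

lemma holomorphic_euler_prod: "euler_prod holomorphic_on ball 0 1"
proof (rule holomorphic_uniform_sequence)
  show "(\<lambda>q. \<Prod>n<N. 1 - q ^ Suc n) holomorphic_on ball 0 1" for N
    by (intro holomorphic_intros)
  fix x :: complex assume x: "x \<in> ball 0 1"
  define d where "d = (1 - norm x) / 2"
  define r where "r = norm x + d"
  have d: "d > 0" and r: "0 \<le> r" "r < 1" using x by (auto simp: d_def r_def field_simps)
  have norm_le: "norm q \<le> r" if "q \<in> cball x d" for q
    using that norm_triangle_sub[of q x] by (auto simp: r_def dist_norm norm_minus_commute)
  have "uniformly_convergent_on (cball x d) (\<lambda>N q. \<Sum>n<N. norm (1 - q ^ Suc n - 1))"
  proof (rule Weierstrass_m_test')
    show "summable (\<lambda>n. r * r ^ n)" using r by (intro summable_mult summable_geometric) auto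
    fix n q assume "q \<in> cball x d"
    then have "norm q ^ Suc n \<le> r ^ Suc n" by (intro power_mono norm_le) auto
    then show "norm (norm (1 - q ^ Suc n - 1)) \<le> r * r ^ n" by (simp add: norm_mult norm_power)
  qed
  then have "uniformly_convergent_on (cball x d) (\<lambda>N q. \<Prod>n<N. 1 - q ^ Suc n)"
    by (intro uniformly_convergent_on_prod' continuous_intros) auto
  then have ul: "uniform_limit (cball x d) (\<lambda>N q. \<Prod>n<N. 1 - q ^ Suc n) (\<lambda>q. lim (\<lambda>N. \<Prod>n<N. 1 - q ^ Suc n)) sequentially"
    by (simp only: uniformly_convergent_uniform_limit_iff)
  have lim_eq: "lim (\<lambda>N. \<Prod>n<N. 1 - q ^ Suc n) = euler_prod q" if "q \<in> cball x d" for q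
  proof -
    have "norm q < 1" using norm_le[OF that] r by simp
    then show ?thesis unfolding euler_prod_def
      by (intro prodinf_eq_lim'[symmetric] convergent_euler_prod power_Suc_neq_1)
  qed
  have "uniform_limit (cball x d) (\<lambda>N q. \<Prod>n<N. 1 - q ^ Suc n) euler_prod sequentially"
    by (intro uniform_limit_cong'[THEN iffD1, OF _ _ ul] lim_eq refl)
  moreover have "cball x d \<subseteq> ball 0 1" using norm_le r by fastforce
  ultimately show "\<exists>d>0. cball x d \<subseteq> ball 0 1 \<and> uniform_limit (cball x d) (\<lambda>N q. \<Prod>n<N. 1 - q ^ Suc n) euler_prod sequentially"
    using d by blast
qed simp

lemma holomorphic_dedekind_eta: "dedekind_eta holomorphic_on {z. Im z > 0}"
proof -
  have "(euler_prod \<circ> (\<lambda>z. exp (2 * of_real pi * \<i> * z))) holomorphic_on {z. Im z > 0}"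
    by (rule holomorphic_on_compose_gen[OF _ holomorphic_euler_prod])
       (auto intro!: holomorphic_intros)
  then show ?thesis
    unfolding dedekind_eta_eq[abs_def] o_def by (intro holomorphic_intros) auto
qed

section \<open>Inversion of eta, from the imaginary axis to the upper half plane\<close>

definition ln_euler_prod :: "real \<Rightarrow> real" where
  "ln_euler_prod y = (\<Sum>n. ln (1 - exp (- (2 * pi * real (Suc n) * y))))"

lemma exp_two_pi_bounds:
  assumes "0 < a" "a \<le> y"
  defines "q \<equiv> exp (- (2 * pi * a))"
  shows "exp (- (2 * pi * real (Suc n) * y)) \<le> q ^ Suc n" "exp (- (2 * pi * real (Suc n) * y)) \<le> q"
proof -
  have q: "0 < q" "q < 1" using assms by auto
  have "real (Suc n) * a \<le> real (Suc n) * y" using assms by (intro mult_left_mono) auto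
  then have "2 * pi * (real (Suc n) * a) \<le> 2 * pi * (real (Suc n) * y)" by (intro mult_left_mono) auto
  then have "exp (- (2 * pi * real (Suc n) * y)) \<le> exp (real (Suc n) * - (2 * pi * a))"
    by (simp only: exp_le_cancel_iff) (simp add: mult_ac)
  also have "\<dots> = q ^ Suc n" unfolding q_def by (rule exp_of_nat_mult)
  finally show *: "exp (- (2 * pi * real (Suc n) * y)) \<le> q ^ Suc n" .
  have "q ^ Suc n \<le> q ^ 1" using q by (intro power_decreasing) auto
  with * show "exp (- (2 * pi * real (Suc n) * y)) \<le> q" by simp
qed

lemma summable_ln_euler_prod:
  assumes y: "y > 0"
  shows "summable (\<lambda>n. ln (1 - exp (- (2 * pi * real (Suc n) * y))))"
proof -
  define q where "q = exp (- (2 * pi * y))"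
  have q: "0 < q" "q < 1" using y by (auto simp: q_def)
  note b = exp_two_pi_bounds[OF y order.refl, folded q_def]
  show ?thesis
  proof (rule summable_comparison_test')
    show "summable (\<lambda>n. q / (1 - q) * q ^ n)" using q by (intro summable_mult summable_geometric) auto
    fix n
    define e where "e = exp (- (2 * pi * real (Suc n) * y))"
    have e: "0 < e" "e < 1" "e \<le> q" "e \<le> q ^ Suc n" using b[of n] y by (auto simp: e_def)
    have "- ln (1 - e) = ln (1 / (1 - e))" using e by (simp add: ln_div)
    also have "\<dots> \<le> 1 / (1 - e) - 1" using e by (intro ln_le_minus_one) auto
    also have "\<dots> = e / (1 - e)" using e by (simp add: field_simps)
    also have "\<dots> \<le> q ^ Suc n / (1 - q)" using e q by (intro frac_le) auto
    finally have "- ln (1 - e) \<le> q ^ Suc n / (1 - q)" .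
    moreover have "ln (1 - e) \<le> 0" using e by simp
    ultimately show "norm (ln (1 - exp (- (2 * pi * real (Suc n) * y)))) \<le> q / (1 - q) * q ^ n"
      unfolding e_def[symmetric] by simp
  qed
qed

lemma DERIV_ln_euler_prod:
  assumes y: "y > 0"
  shows "(ln_euler_prod has_real_derivative lambert y) (at y)"
proof -
  \<comment> \<open>Uniform convergence of the derivatives needs a positive lower bound for the
    argument, and y must be interior to the half-line from a; any a strictly between 0 and y has
    both properties.\<close>
  define a where "a = y / 2"
  have a: "a > 0" "a < y" using y by (auto simp: a_def)
  define q where "q = exp (- (2 * pi * a))"
  have q: "0 < q" "q < 1" using a by (auto simp: q_def)
  note b = exp_two_pi_bounds[OF a(1), folded q_def]
  show ?thesis unfolding ln_euler_prod_def[abs_def] lambert_def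
  proof (rule has_field_derivative_series'(2)[of "{a..}"])
    fix n x assume "x \<in> {a..}"
    then have x: "a \<le> x" "0 < x" using a by auto
    define e where "e = exp (- (2 * pi * real (Suc n) * x))"
    have e: "0 < e" "e < 1" using x by (auto simp: e_def)
    have inv: "exp (2 * pi * real (Suc n) * x) = 1 / e" by (simp only: e_def exp_minus inverse_eq_divide) simp
    have "((\<lambda>x. ln (1 - exp (- (2 * pi * real (Suc n) * x)))) has_real_derivative (2 * pi * real (Suc n) * e / (1 - e))) (at x within {a..})"
      using e unfolding e_def by (auto intro!: derivative_eq_intros simp del: of_nat_Suc)
    also have "2 * pi * real (Suc n) * e / (1 - e) = 2 * pi * real (Suc n) / (exp (2 * pi * real (Suc n) * x) - 1)"
      unfolding inv using e by (simp add: divide_simps)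
    finally show "((\<lambda>x. ln (1 - exp (- (2 * pi * real (Suc n) * x)))) has_real_derivative
        2 * pi * real (Suc n) / (exp (2 * pi * real (Suc n) * x) - 1)) (at x within {a..})" .
  next
    show "uniformly_convergent_on {a..} (\<lambda>n x. \<Sum>i<n. 2 * pi * real (Suc i) / (exp (2 * pi * real (Suc i) * x) - 1))"
    proof (rule Weierstrass_m_test')
      show "summable (\<lambda>n. 2 * pi * q / (1 - q) * (real (Suc n) * q ^ n))"
        using q by (intro summable_mult sums_summable[OF geometric_deriv_sums]) auto
      fix n x assume "x \<in> {a..}"
      then have x: "a \<le> x" "0 < x" using a by auto
      define e where "e = exp (- (2 * pi * real (Suc n) * x))"
      have e: "0 < e" "e < 1" "e \<le> q" "e \<le> q ^ Suc n" "q < 1" using b[OF x(1), of n] x q by (auto simp: e_def)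
      have inv: "exp (2 * pi * real (Suc n) * x) = 1 / e" by (simp only: e_def exp_minus inverse_eq_divide) simp
      have "1 / (1 / e - 1) = e / (1 - e)" using e by (simp add: field_simps)
      also have "\<dots> \<le> q ^ Suc n / (1 - q)" using e by (intro frac_le) auto
      finally have "2 * pi * real (Suc n) * (1 / (1 / e - 1)) \<le> 2 * pi * real (Suc n) * (q ^ Suc n / (1 - q))"
        by (intro mult_left_mono) auto
      moreover have "1 / e > 1" using e by simp
      ultimately show "norm (2 * pi * real (Suc n) / (exp (2 * pi * real (Suc n) * x) - 1)) \<le> 2 * pi * q / (1 - q) * (real (Suc n) * q ^ n)"
        unfolding inv by (simp add: mult_ac)
    qed
  next
    show "summable (\<lambda>n. ln (1 - exp (- (2 * pi * real (Suc n) * y))))" by (rule summable_ln_euler_prod[OF y])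
  qed (use a in auto)
qed

text \<open>The difference \<open>G\<close> of the two sides has derivative zero by
  \<open>lambert_inversion\<close>, and it vanishes at the fixed point 1 of the inversion. The term
  \<open>ln y / 2\<close> integrates the defect \<open>1 / (2 * y)\<close>.\<close>

lemma ln_euler_prod_inversion:
  assumes y: "y > 0"
  shows "ln_euler_prod (1 / y) - pi / (12 * y) = ln_euler_prod y - pi * y / 12 + ln y / 2"
proof -
  define G where "G y = ln_euler_prod y - pi * y / 12 + ln y / 2 - ln_euler_prod (1 / y) + pi / (12 * y)" for y
  have "\<exists>c. \<forall>x\<in>{0<..}. G x = c"
  proof (rule has_field_derivative_zero_constant)
    fix x :: real assume "x \<in> {0<..}"
    then have x: "x > 0" by simp
    have "(G has_real_derivative lambert x - pi / 12 + 1 / (2 * x) - lambert (1 / x) * (- 1 / x^2) + (- pi / (12 * x^2))) (at x)"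
    proof -
      have "((\<lambda>x. ln_euler_prod (1 / x)) has_real_derivative lambert (1 / x) * (- 1 / x^2)) (at x)"
        by (rule DERIV_chain2[OF DERIV_ln_euler_prod])
           (use x in \<open>auto intro!: derivative_eq_intros simp: power2_eq_square\<close>)
      then show ?thesis unfolding G_def using x
        by (auto intro!: derivative_eq_intros DERIV_ln_euler_prod simp: power2_eq_square)
    qed
    moreover have "lambert x - pi / 12 + 1 / (2 * x) - lambert (1 / x) * (- 1 / x^2) + (- pi / (12 * x^2)) = 0"
      using lambert_inversion[OF x] by simp
    ultimately show "(G has_field_derivative 0) (at x within {0<..})"
      by (simp add: has_field_derivative_at_within)
  qed auto
  then have "G y = G 1" using y by auto
  then show ?thesis by (simp add: G_def)
qed

lemma dedekind_eta_imaginary_axis: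
  assumes y: "y > 0"
  shows "dedekind_eta (\<i> * of_real y) = of_real (exp (ln_euler_prod y - pi * y / 12))"
proof -
  have "(\<Prod>n. 1 - exp (2 * of_real pi * \<i> * (\<i> * of_real y)) ^ Suc n)
      = (\<Prod>n. exp (complex_of_real (ln (1 - exp (- (2 * pi * real (Suc n) * y))))))"
  proof (rule prodinf_cong)
    fix n
    have "exp (2 * of_real pi * \<i> * (\<i> * of_real y)) = complex_of_real (exp (- (2 * pi * y)))"
      by (simp add: exp_of_real[symmetric] algebra_simps del: exp_of_real)
    then have "exp (2 * of_real pi * \<i> * (\<i> * of_real y)) ^ Suc n = complex_of_real (exp (- (2 * pi * y)) ^ Suc n)"
      by (simp only: of_real_power)
    also have "exp (- (2 * pi * y)) ^ Suc n = exp (- (2 * pi * real (Suc n) * y))"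
      unfolding exp_of_nat_mult[symmetric] by (simp add: mult_ac)
    finally have 1: "1 - exp (2 * of_real pi * \<i> * (\<i> * of_real y)) ^ Suc n = complex_of_real (1 - exp (- (2 * pi * real (Suc n) * y)))"
      by (simp only: of_real_diff of_real_1)
    have "exp (- (2 * pi * real (Suc n) * y)) < 1" using y by simp
    then have "1 - exp (- (2 * pi * real (Suc n) * y)) = exp (ln (1 - exp (- (2 * pi * real (Suc n) * y))))"
      by simp
    then show "1 - exp (2 * of_real pi * \<i> * (\<i> * of_real y)) ^ Suc n = exp (complex_of_real (ln (1 - exp (- (2 * pi * real (Suc n) * y)))))"
      unfolding 1 by (simp only: exp_of_real)
  qed
  also have "\<dots> = exp (\<Sum>n. complex_of_real (ln (1 - exp (- (2 * pi * real (Suc n) * y)))))"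
    by (intro prodinf_exp summable_of_real summable_ln_euler_prod y)
  also have "\<dots> = of_real (exp (ln_euler_prod y))"
    unfolding ln_euler_prod_def by (simp only: suminf_of_real[OF summable_ln_euler_prod[OF y], symmetric] exp_of_real)
  finally have "dedekind_eta (\<i> * of_real y) = exp (2 * of_real pi * \<i> * (\<i> * of_real y) / 24) * of_real (exp (ln_euler_prod y))"
    by (simp only: dedekind_eta_def)
  also have "exp (2 * of_real pi * \<i> * (\<i> * of_real y) / 24) = complex_of_real (exp (- (pi * y / 12)))"
    by (simp add: exp_of_real[symmetric] algebra_simps del: exp_of_real)
  finally show ?thesis
    by (simp only: of_real_mult[symmetric] exp_add[symmetric]) (simp add: algebra_simps)
qed

lemma Im_minus_inverse: "Im (- 1 / z) = Im z / norm z ^ 2"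
  by (simp add: Im_divide cmod_power2)

text \<open>Stated for squares, so that both sides are holomorphic without a choice of the square
  root of -i z.\<close>

theorem dedekind_eta_inversion:
  assumes z: "Im z > 0"
  shows "dedekind_eta (- 1 / z) ^ 2 = - \<i> * z * dedekind_eta z ^ 2"
proof -
  define H where "H = {z. Im z > 0}"
  define f where "f z = dedekind_eta (- 1 / z) ^ 2 + \<i> * z * dedekind_eta z ^ 2" for z
  define U where "U = (\<lambda>y. \<i> * complex_of_real y) ` {0<..}"
  have "f z = 0"
  proof (rule analytic_continuation[where f = f and S = H and U = U and \<xi> = \<i>])
    have "(dedekind_eta \<circ> (\<lambda>z. - 1 / z)) holomorphic_on H"
    proof (rule holomorphic_on_compose_gen[OF _ holomorphic_dedekind_eta])
      show "(\<lambda>z. - 1 / z) holomorphic_on H"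
        by (intro holomorphic_intros) (auto simp: H_def)
      show "(\<lambda>z. - 1 / z) ` H \<subseteq> {z. Im z > 0}"
        unfolding image_subset_iff mem_Collect_eq Im_minus_inverse
        by (auto simp: H_def intro!: divide_pos_pos)
    qed
    then show "f holomorphic_on H"
      unfolding f_def o_def by (intro holomorphic_intros holomorphic_dedekind_eta[folded H_def])
    show "open H" "connected H" unfolding H_def
      by (auto intro!: convex_connected convex_halfspace_Im_gt open_halfspace_Im_gt)
    show "U \<subseteq> H" "\<i> \<in> H" by (auto simp: U_def H_def)
    show "\<i> islimpt U"
      unfolding islimpt_approachable
    proof (intro allI impI)
      fix e :: real assume e: "e > 0"
      have "\<i> * complex_of_real (1 + e / 2) \<in> U" unfolding U_def using e by (intro imageI) auto
      moreover have "dist (\<i> * complex_of_real (1 + e / 2)) \<i> < e"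
        using e by (simp add: dist_norm algebra_simps norm_mult)
      ultimately show "\<exists>x'\<in>U. x' \<noteq> \<i> \<and> dist x' \<i> < e"
        using e by (intro bexI[of _ "\<i> * complex_of_real (1 + e / 2)"]) (auto simp: complex_eq_iff)
    qed
    show "z \<in> H" using z by (simp add: H_def)
    fix w assume "w \<in> U"
    then obtain y where w: "w = \<i> * of_real y" and y: "y > 0" by (auto simp: U_def)
    have "- 1 / w = \<i> * of_real (1 / y)" using y by (simp add: w field_simps)
    then have 1: "dedekind_eta (- 1 / w) = of_real (exp (ln_euler_prod (1 / y) - pi / (12 * y)))"
      using dedekind_eta_imaginary_axis[of "1 / y"] y by (simp only:) simp
    have 2: "exp (ln_euler_prod (1 / y) - pi / (12 * y)) = exp (ln_euler_prod y - pi * y / 12) * sqrt y"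
      unfolding ln_euler_prod_inversion[OF y] exp_add using y by (simp add: ln_sqrt[symmetric])
    have "dedekind_eta (- 1 / w) ^ 2 = of_real y * dedekind_eta w ^ 2"
      unfolding 1 2 using dedekind_eta_imaginary_axis[OF y] y
      by (simp add: w power_mult_distrib flip: of_real_power)
    then show "f w = 0" by (simp add: f_def w)
  qed
  then show ?thesis by (simp add: f_def eq_neg_iff_add_eq_0)
qed

section \<open>Invariance under the modular group\<close>

text \<open>Im z picks up the factor |c z + d|^(-2) and |eta| the factor |c z + d|^(1/2), hence the
  fourth power.\<close>

definition eta_height :: "complex \<Rightarrow> real" where
  "eta_height z = Im z * norm (dedekind_eta z) ^ 4"

lemma eta_height_minus_inverse:
  assumes "Im z > 0"
  shows "eta_height (- 1 / z) = eta_height z"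
proof -
  have "z \<noteq> 0" using assms by auto
  have "norm (dedekind_eta (- 1 / z)) ^ 2 = norm z * norm (dedekind_eta z) ^ 2"
    using arg_cong[OF dedekind_eta_inversion[OF assms], of norm] by (simp add: norm_mult norm_power)
  then have "(norm (dedekind_eta (- 1 / z)) ^ 2) ^ 2 = norm z ^ 2 * norm (dedekind_eta z) ^ 4"
    by (simp add: power_mult_distrib flip: power_mult)
  then show ?thesis using \<open>z \<noteq> 0\<close>
    unfolding eta_height_def Im_minus_inverse by (simp flip: power_mult)
qed

lemma eta_height_add_of_int: "eta_height (z + of_int n) = eta_height z"
proof -
  have "exp (2 * of_real pi * \<i> * (z + of_int n)) = exp (2 * of_real pi * \<i> * z)"
  proof -
    have "2 * of_real pi * \<i> * (z + of_int n) = 2 * of_real pi * \<i> * z + \<i> * (of_int n * (of_real pi * 2))"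
      by (simp only: distrib_left mult_ac)
    then show ?thesis by (simp only: exp_plus_2pin)
  qed
  then have "norm (dedekind_eta (z + of_int n)) = norm (dedekind_eta z)"
    unfolding dedekind_eta_eq norm_mult by simp
  then show ?thesis by (simp add: eta_height_def)
qed

lemma cz_add_d_nonzero:
  fixes c d :: int
  assumes "Im z > 0" "c \<noteq> 0 \<or> d \<noteq> 0"
  shows "of_int c * z + of_int d \<noteq> (0 :: complex)"
  using assms by (auto simp: complex_eq_iff)

lemma Im_moebius:
  fixes a b c d :: int
  assumes "a * d - b * c = 1"
  shows "Im (moebius (of_int a) (of_int b) (of_int c) (of_int d) z) = Im z / norm (of_int c * z + of_int d) ^ 2"
proof -
  have "real_of_int (a * d - b * c) = 1" using assms by simp
  then have det: "real_of_int a * of_int d = 1 + of_int b * of_int c" by simp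
  have "Im ((of_int a * z + of_int b) * cnj (of_int c * z + of_int d)) = (real_of_int a * of_int d - of_int b * of_int c) * Im z"
    by (simp add: algebra_simps)
  then show ?thesis
    by (simp add: moebius_def Im_divide det cmod_power2 algebra_simps)
qed

text \<open>The induction on |c| is the Euclidean algorithm: with \<open>a = q * c + r\<close> the
  matrix is a translation by q times the inversion times a matrix with lower left entry r.\<close>

theorem eta_height_moebius:
  fixes a b c d :: int
  assumes "a * d - b * c = 1" "Im z > 0"
  shows "eta_height (moebius (of_int a) (of_int b) (of_int c) (of_int d) z) = eta_height z"
  using assms(1)
proof (induction "nat \<bar>c\<bar>" arbitrary: a b c d rule: less_induct)
  case less
  show ?case
  proof (cases "c = 0")
    case True
    then have "a * d = 1" using less.prems by simp
    then have "a = 1 \<and> d = 1 \<or> a = -1 \<and> d = -1" by (simp add: zmult_eq_1_iff)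
    then have "moebius (of_int a) (of_int b) (of_int c) (of_int d) z = z + of_int (b * d)"
      by (auto simp: moebius_def True)
    then show ?thesis by (simp only: eta_height_add_of_int)
  next
    case False
    define q r b' where "q = a div c" and "r = a mod c" and "b' = b - q * d"
    have a: "a = q * c + r" by (simp add: q_def r_def)
    have det: "(- c) * b' - (- d) * r = 1" using less.prems by (simp add: a b'_def algebra_simps)
    have r: "nat \<bar>r\<bar> < nat \<bar>c\<bar>" using False abs_mod_less[of c a] by (simp add: r_def)
    define X Y where "X = of_int c * z + of_int d" and "Y = of_int r * z + of_int b'"
    have nz: "X \<noteq> 0" "Y \<noteq> 0" unfolding X_def Y_def
      using det False by (intro cz_add_d_nonzero[OF assms(2)]; auto)+
    define w where "w = moebius (of_int (- c)) (of_int (- d)) (of_int r) (of_int b') z"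
    have "Im w > 0" unfolding w_def Im_moebius[OF det] Y_def[symmetric] using nz assms(2) by simp
    have "w = - X / Y" by (simp add: w_def moebius_def X_def Y_def algebra_simps)
    moreover have "of_int a * z + of_int b = of_int q * X + Y"
      by (simp add: a b'_def X_def Y_def algebra_simps)
    moreover have "moebius (of_int a) (of_int b) (of_int c) (of_int d) z = (of_int a * z + of_int b) / X"
      by (simp add: moebius_def X_def)
    ultimately have "moebius (of_int a) (of_int b) (of_int c) (of_int d) z = - 1 / w + of_int q"
      using nz by (simp only:) (simp add: add_divide_distrib)
    then have "eta_height (moebius (of_int a) (of_int b) (of_int c) (of_int d) z) = eta_height w"
      using \<open>Im w > 0\<close> by (simp only: eta_height_add_of_int eta_height_minus_inverse)
    also have "\<dots> = eta_height z" unfolding w_def by (rule less.hyps[OF r det])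
    finally show ?thesis .
  qed
qed

corollary ln_norm_eta_moebius:
  fixes a b c d :: int
  assumes "a * d - b * c = 1" "Im z > 0"
  shows "ln (norm (dedekind_eta (moebius (of_int a) (of_int b) (of_int c) (of_int d) z)))
    = ln (norm (of_int c * z + of_int d :: complex)) / 2 + ln (norm (dedekind_eta z))"
proof -
  define w where "w = moebius (of_int a) (of_int b) (of_int c) (of_int d) z"
  define N where "N = norm (of_int c * z + of_int d :: complex)"
  have "c \<noteq> 0 \<or> d \<noteq> 0" using assms(1) by auto
  then have N: "N > 0" using cz_add_d_nonzero[OF assms(2)] by (simp add: N_def)
  have Im: "Im w = Im z / N ^ 2" unfolding w_def N_def by (rule Im_moebius[OF assms(1)])
  then have "Im w > 0" using N assms by simp
  then have pos: "norm (dedekind_eta w) > 0" "norm (dedekind_eta z) > 0"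
    using dedekind_eta_nonzero assms(2) by auto
  have "norm (dedekind_eta w) ^ 4 = N ^ 2 * norm (dedekind_eta z) ^ 4"
    using eta_height_moebius[OF assms] N assms(2) Im unfolding eta_height_def w_def[symmetric] by (simp add: field_simps)
  then have "ln (norm (dedekind_eta w) ^ 4) = ln (N ^ 2 * norm (dedekind_eta z) ^ 4)" by simp
  then have "4 * ln (norm (dedekind_eta w)) = 2 * ln N + 4 * ln (norm (dedekind_eta z))"
    using N pos by (simp add: ln_mult ln_realpow)
  then show ?thesis by (simp add: w_def N_def)
qed

section \<open>Orders at the cusps\<close>

lemma euler_prod_0 [simp]: "euler_prod 0 = 1"
  by (simp add: euler_prod_def)

text \<open>As Im z tends to infinity, q tends to 0. The infinite product then contributes only a
  bounded error, and the order comes from the exponential prefactor of eta alone.\<close>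

lemma ln_norm_euler_prod_near_0:
  "\<exists>e>0. \<forall>q. norm q < e \<longrightarrow> \<bar>ln (norm (euler_prod q))\<bar> \<le> 1"
proof -
  have "isCont euler_prod 0"
    using holomorphic_on_imp_continuous_on[OF holomorphic_euler_prod]
    by (simp add: continuous_on_eq_continuous_at)
  then have "isCont (\<lambda>q. ln (norm (euler_prod q))) 0"
    by (intro continuous_intros) auto
  then have "((\<lambda>q. ln (norm (euler_prod q))) \<longlongrightarrow> 0) (nhds 0)"
    by (simp add: isCont_def tendsto_nhds_iff)
  then have "\<forall>\<^sub>F q in nhds 0. dist (ln (norm (euler_prod q))) 0 < 1"
    by (rule tendstoD) simp
  then obtain e where "e > 0" "\<And>q. dist q 0 < e \<Longrightarrow> dist (ln (norm (euler_prod q))) 0 < 1"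
    unfolding eventually_nhds_metric by blast
  then show ?thesis by (intro exI[of _ e]) (auto simp: dist_norm less_imp_le)
qed

lemma coprime_bezout_int:
  fixes a c :: int
  assumes "coprime a c"
  obtains u v where "a * u - v * c = 1"
proof -
  obtain u v where "u * a + v * c = 1" using bezout_int[of a c] assms by auto
  then show ?thesis by (intro that[of u "- v"]) (simp add: algebra_simps)
qed

text \<open>\<open>diag(n, 1) \<gamma>\<close> equals a unimodular matrix times an upper triangular one, whose diagonal entries
  are \<open>gcd(c, n)\<close> and \<open>n / gcd(c, n)\<close>.\<close>

lemma ln_norm_eta_at_cusp:
  fixes a b c d :: int and n :: nat
  assumes det: "a * d - b * c = 1" and n: "n > 0"
  shows "\<exists>y>0. \<exists>B. \<forall>z. Im z > y \<longrightarrow>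
    \<bar>ln (norm (dedekind_eta (of_nat n * moebius (of_int a) (of_int b) (of_int c) (of_int d) z)))
      - ln (norm (of_int c * z + of_int d :: complex)) / 2 + pi / 12 * (real (gcd (nat \<bar>c\<bar>) n) ^ 2 / real n) * Im z\<bar> \<le> B"
proof -
  obtain e where e: "e > 0" "\<And>q. norm q < e \<Longrightarrow> \<bar>ln (norm (euler_prod q))\<bar> \<le> 1"
    using ln_norm_euler_prod_near_0 by blast
  define g where "g = gcd c (int n)"
  have g_nat: "g = int (gcd (nat \<bar>c\<bar>) n)" 
    unfolding g_def gcd_int_int_eq[symmetric] by simp
  have g: "g > 0" using n by (simp add: g_def)
  have "coprime a c"
  proof (rule coprimeI)
    fix k assume "k dvd a" "k dvd c"
    then have "k dvd a * d - b * c" by simp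
    then show "is_unit k" using det by simp
  qed
  obtain n' c' where n': "int n = g * n'" and c': "c = g * c'" unfolding g_def by (meson dvdE gcd_dvd1 gcd_dvd2)
  have cop: "coprime n' c'"
  proof -
    have "gcd (int n) c = g * gcd n' c'" using g by (simp add: n' c' gcd_mult_distrib_int[symmetric])
    then have "gcd n' c' = 1" using g n unfolding g_def by (simp add: gcd.commute[of c])
    then show ?thesis by (simp add: coprime_iff_gcd_eq_1)
  qed
  define a' where "a' = n' * a"
  have "coprime a' c'" unfolding a'_def using cop \<open>coprime a c\<close> c' by (simp add: coprime_mult_left_iff)
  then obtain d' b' where det': "a' * d' - b' * c' = 1" using coprime_bezout_int by metis
  define D where "D = n'"
  define B where "B = d' * (int n * b) - b' * d"
  have D: "D > 0" using n g n' unfolding D_def by (metis of_nat_0_less_iff zero_less_mult_pos)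
  have D_eq: "D = a' * d - c' * (int n * b)"
  proof -
    have "a' * d - c' * (int n * b) = n' * (a * d - b * c)"
      by (simp add: a'_def n' c' algebra_simps)
    then show ?thesis by (simp add: det D_def)
  qed
  \<comment> \<open>The equations \<open>e1\<close> to \<open>e4\<close> are the four entries of the
    identity between the matrix with rows (n a, n b), (c, d) and the product of the unimodular
    matrix with rows (a', b'), (c', d') and the triangular one with rows (g, B), (0, D).\<close>
  have e1: "a' * g = int n * a" by (simp add: a'_def n')
  have e2: "a' * B + b' * D = int n * b"
  proof -
    have "a' * B + b' * D = (a' * d' - b' * c') * (int n * b)" unfolding B_def D_eq by (simp add: algebra_simps)
    then show ?thesis by (simp add: det')
  qed
  have e3: "c' * g = c" by (simp add: c')
  have e4: "c' * B + d' * D = d"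
  proof -
    have "c' * B + d' * D = (a' * d' - b' * c') * d" unfolding B_def D_eq by (simp add: algebra_simps)
    then show ?thesis by (simp add: det')
  qed
  \<comment> \<open>The factor n compensates for \<open>Im w\<close> being possibly as small as Im z
    / n. Then Im w exceeds |ln e| + 1, so that |q| = exp(-2 pi Im w) is below e.\<close>
  define y where "y = real n * (\<bar>ln e\<bar> + 1)"
  have y: "y > 0" using n unfolding y_def by (intro mult_pos_pos) auto
  show ?thesis
  proof (rule exI[of _ y], rule conjI[OF y], rule exI[of _ "\<bar>ln D\<bar> / 2 + 1"], intro allI impI)
    fix z :: complex assume z: "Im z > y"
    define w where "w = (of_int g * z + of_int B) / of_int D"
    have rat: "real_of_int g / of_int D = (real (gcd (nat \<bar>c\<bar>) n))\<^sup>2 / real n"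
    proof -
      have "real n = of_int g * of_int D" using n' unfolding D_def by (metis of_int_mult of_int_of_nat_eq)
      then show ?thesis using g by (simp add: g_nat power2_eq_square)
    qed
    have "w = complex_of_real (of_int g / of_int D) * z + complex_of_real (of_int B / of_int D)"
      by (simp add: w_def add_divide_distrib)
    then have Im_w: "Im w = (real (gcd (nat \<bar>c\<bar>) n))\<^sup>2 / real n * Im z"
      unfolding rat[symmetric] by simp
    have "1 / real n * Im z \<le> Im w"
    proof -
      have "1 \<le> gcd (nat \<bar>c\<bar>) n" using n by (simp add: Suc_leI)
      then have "1 \<le> (real (gcd (nat \<bar>c\<bar>) n))\<^sup>2" by simp
      then show ?thesis unfolding Im_w using z y by (intro mult_right_mono divide_right_mono) auto
    qed
    moreover have "1 / real n * Im z > \<bar>ln e\<bar> + 1" using z n unfolding y_def by (simp add: field_simps)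
    ultimately have big: "Im w > \<bar>ln e\<bar> + 1" by linarith
    then have Im_w_pos: "Im w > 0" by linarith
    have "of_nat n * moebius (of_int a) (of_int b) (of_int c) (of_int d) z
        = (of_int (int n * a) * z + of_int (int n * b)) / (of_int c * z + of_int d)"
      by (simp add: moebius_def algebra_simps)
    also have "\<dots> = (of_int a' * (of_int g * z + of_int B) + of_int b' * of_int D) / (of_int c' * (of_int g * z + of_int B) + of_int d' * of_int D)"
      unfolding e1[symmetric] e2[symmetric]
      by (subst e3[symmetric], subst e4[symmetric]) (simp add: algebra_simps)
    also have "\<dots> = moebius (of_int a') (of_int b') (of_int c') (of_int d') w"
    proof -
      have "of_int g * z + of_int B = w * of_int D" using D by (simp add: w_def)
      then have "(of_int a' * (of_int g * z + of_int B) + of_int b' * of_int D) = (of_int a' * w + of_int b') * of_int D"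
        "(of_int c' * (of_int g * z + of_int B) + of_int d' * of_int D) = (of_int c' * w + of_int d') * of_int D"
        by (simp_all add: algebra_simps)
      then show ?thesis using D by (simp add: moebius_def)
    qed
    finally have "ln (norm (dedekind_eta (of_nat n * moebius (of_int a) (of_int b) (of_int c) (of_int d) z)))
      = ln (norm (of_int c' * w + of_int d' :: complex)) / 2 + ln (norm (dedekind_eta w))"
      by (simp only: ln_norm_eta_moebius[OF det' Im_w_pos])
    also have "of_int c' * w + of_int d' = (of_int c * z + of_int d) / of_int D"
    proof -
      have "of_int c * z + of_int d = of_int c' * (of_int g * z + of_int B) + of_int d' * of_int D"
        by (subst e3[symmetric], subst e4[symmetric]) (simp add: algebra_simps)
      then show ?thesis using D by (simp add: w_def field_simps)
    qed
    also have "ln (norm ((of_int c * z + of_int d :: complex) / of_int D)) = ln (norm (of_int c * z + of_int d :: complex)) - ln D"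
    proof -
      have "c \<noteq> 0 \<or> d \<noteq> 0" using det by auto
      then have "of_int c * z + of_int d \<noteq> 0" using cz_add_d_nonzero z y by force
      then show ?thesis using D by (simp add: norm_divide ln_div)
    qed
    also have "ln (norm (dedekind_eta w)) = - (pi / 12) * Im w + ln (norm (euler_prod (exp (2 * of_real pi * \<i> * w))))"
    proof -
      have "euler_prod (exp (2 * of_real pi * \<i> * w)) \<noteq> 0"
        by (intro euler_prod_nonzero norm_exp_two_pi_ii_less_1 Im_w_pos)
      then show ?thesis unfolding dedekind_eta_eq norm_mult by (simp add: ln_mult)
    qed
    finally have eq: "ln (norm (dedekind_eta (of_nat n * moebius (of_int a) (of_int b) (of_int c) (of_int d) z)))
       = (ln (norm (of_int c * z + of_int d :: complex)) - ln D) / 2 + (- (pi / 12) * Im w + ln (norm (euler_prod (exp (2 * of_real pi * \<i> * w)))))" .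
    have "\<bar>ln (norm (euler_prod (exp (2 * of_real pi * \<i> * w))))\<bar> \<le> 1"
    proof (rule e(2))
      have "1 * Im w \<le> 2 * pi * Im w" using Im_w_pos pi_gt3 by (intro mult_right_mono) auto
      then have "- 2 * pi * Im w < ln e" using big by linarith
      then have "exp (- 2 * pi * Im w) < e" using e(1) by (metis exp_less_cancel_iff exp_ln)
      then show "norm (exp (2 * of_real pi * \<i> * w)) < e" by (simp only: norm_exp_two_pi_ii)
    qed
    then show "\<bar>ln (norm (dedekind_eta (of_nat n * moebius (of_int a) (of_int b) (of_int c) (of_int d) z)))
      - ln (norm (of_int c * z + of_int d :: complex)) / 2 + pi / 12 * (real (gcd (nat \<bar>c\<bar>) n) ^ 2 / real n) * Im z\<bar> \<le> \<bar>ln D\<bar> / 2 + 1"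
      unfolding eq Im_w by (simp add: diff_divide_distrib)
  qed
qed

section \<open>Orders of eta quotients and holomorphy\<close>

text \<open>Up to a constant factor, the transform at a cusp a / c has absolute value
  |q|^(cusp_order / 24) as q tends to 0. The width of the cusp is left out, since only signs and
  comparisons matter; c = 0 is the cusp at infinity.\<close>

definition cusp_order :: "(nat \<Rightarrow> int) \<Rightarrow> nat \<Rightarrow> real" where
  "cusp_order X c = (\<Sum>d | X d \<noteq> 0. real (gcd c d) ^ 2 / real d * of_int (X d))"

lemma ln_norm_power_int:
  fixes x :: complex
  assumes "x \<noteq> 0"
  shows "ln (norm (x powi k)) = of_int k * ln (norm x)"
proof -
  have "norm x powi k = norm x powr real_of_int k"
    using powr_real_of_int'[of "norm x" k] assms by simp
  then show ?thesis using assms by (simp add: norm_power_int ln_powr)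
qed

lemma ln_norm_eta_quotient:
  assumes X: "eta_exponents X" and z: "Im z > 0"
  shows "ln (norm (eta_quotient X z)) = (\<Sum>d | X d \<noteq> 0. of_int (X d) * ln (norm (dedekind_eta (of_nat d * z))))"
    and "eta_quotient X z \<noteq> 0"
proof -
  have nz: "dedekind_eta (of_nat d * z) \<noteq> 0" if "X d \<noteq> 0" for d
    using that X z by (intro dedekind_eta_nonzero) (cases "d = 0", auto simp: eta_exponents_def)
  show "eta_quotient X z \<noteq> 0"
    using nz z X by (auto simp: eta_quotient_def eta_exponents_def)
  have "ln (norm (eta_quotient X z)) = ln (\<Prod>d | X d \<noteq> 0. norm (dedekind_eta (of_nat d * z) powi X d))"
    using z by (simp add: eta_quotient_def prod_norm)
  also have "\<dots> = (\<Sum>d | X d \<noteq> 0. ln (norm (dedekind_eta (of_nat d * z) powi X d)))"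
    using X nz by (intro ln_prod) (auto simp: eta_exponents_def)
  also have "\<dots> = (\<Sum>d | X d \<noteq> 0. of_int (X d) * ln (norm (dedekind_eta (of_nat d * z))))"
    by (intro sum.cong refl ln_norm_power_int nz) auto
  finally show "ln (norm (eta_quotient X z)) = (\<Sum>d | X d \<noteq> 0. of_int (X d) * ln (norm (dedekind_eta (of_nat d * z))))" .
qed

lemma ln_norm_eta_quotient_at_cusp:
  fixes a b c d :: int
  assumes X: "eta_exponents X" and det: "a * d - b * c = 1"
  shows "\<exists>y>0. \<exists>B. \<forall>z. Im z > y \<longrightarrow>
    \<bar>ln (norm (eta_quotient X (moebius (of_int a) (of_int b) (of_int c) (of_int d) z)))
      - eta_weight X * ln (norm (of_int c * z + of_int d :: complex))
      + pi / 12 * cusp_order X (nat \<bar>c\<bar>) * Im z\<bar> \<le> B"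
proof -
  define S where "S = {n. X n \<noteq> 0}"
  have S: "finite S" "\<And>n. n \<in> S \<Longrightarrow> n > 0"
    using X by (auto simp: S_def eta_exponents_def) (metis gr0I)
  define T where "T n z = ln (norm (dedekind_eta (of_nat n * moebius (of_int a) (of_int b) (of_int c) (of_int d) z)))
      - ln (norm (of_int c * z + of_int d :: complex)) / 2 + pi / 12 * (real (gcd (nat \<bar>c\<bar>) n) ^ 2 / real n) * Im z" for n z
  have "\<forall>n\<in>S. \<exists>y B. y > 0 \<and> (\<forall>z. Im z > y \<longrightarrow> \<bar>T n z\<bar> \<le> B)"
    unfolding T_def using ln_norm_eta_at_cusp[OF det S(2)] by blast
  then obtain y B where yB: "\<And>n. n \<in> S \<Longrightarrow> y n > 0" "\<And>n z. n \<in> S \<Longrightarrow> Im z > y n \<Longrightarrow> \<bar>T n z\<bar> \<le> B n"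
    by metis
  define y' where "y' = 1 + (\<Sum>n\<in>S. y n)"
  have y': "y' > 0" "\<And>n. n \<in> S \<Longrightarrow> y n \<le> y'"
  proof -
    have "(\<Sum>n\<in>S. y n) \<ge> 0" using yB(1) by (intro sum_nonneg) (auto simp: less_imp_le)
    then show "y' > 0" by (simp add: y'_def)
    fix n assume "n \<in> S"
    then have "y n \<le> (\<Sum>n\<in>S. y n)" using yB(1) S by (intro member_le_sum) (auto simp: less_imp_le)
    then show "y n \<le> y'" by (simp add: y'_def)
  qed
  show ?thesis
  proof (rule exI[of _ y'], rule conjI[OF y'(1)], rule exI[of _ "\<Sum>n\<in>S. \<bar>of_int (X n)\<bar> * B n"], intro allI impI)
    fix z :: complex assume z: "Im z > y'"
    define w where "w = moebius (of_int a) (of_int b) (of_int c) (of_int d) z"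
    have "c \<noteq> 0 \<or> d \<noteq> 0" using det by auto
    then have "of_int c * z + of_int d \<noteq> 0" using cz_add_d_nonzero z y'(1) by force
    then have "Im w > 0" unfolding w_def Im_moebius[OF det] using z y'(1) by simp
    have "ln (norm (eta_quotient X w)) - eta_weight X * ln (norm (of_int c * z + of_int d :: complex))
      + pi / 12 * cusp_order X (nat \<bar>c\<bar>) * Im z = (\<Sum>n\<in>S. of_int (X n) * T n z)"
      unfolding ln_norm_eta_quotient(1)[OF X \<open>Im w > 0\<close>] T_def w_def[symmetric] cusp_order_def eta_weight_def S_def
      by (simp add: sum_distrib_left sum_distrib_right sum_subtractf sum.distrib algebra_simps sum_divide_distrib)
    also have "\<bar>\<dots>\<bar> \<le> (\<Sum>n\<in>S. \<bar>of_int (X n) * T n z\<bar>)" by (rule sum_abs)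
    also have "\<dots> \<le> (\<Sum>n\<in>S. \<bar>of_int (X n)\<bar> * B n)"
      unfolding abs_mult using z y' by (intro sum_mono mult_left_mono yB(2)) fastforce+
    finally show "\<bar>ln (norm (eta_quotient X (moebius (of_int a) (of_int b) (of_int c) (of_int d) z)))
      - eta_weight X * ln (norm (of_int c * z + of_int d :: complex))
      + pi / 12 * cusp_order X (nat \<bar>c\<bar>) * Im z\<bar> \<le> (\<Sum>n\<in>S. \<bar>of_int (X n)\<bar> * B n)"
      by (simp add: w_def)
  qed
qed

text \<open>Up to a bounded error the logarithm of the transform is
  \<open>- pi / 12 * cusp_order X c * Im z\<close>, and boundedness from above is decided by the
  sign of the coefficient.\<close>

lemma no_poles_at_cusps_iff:
  assumes X: "eta_exponents X"
  shows "no_poles_at_cusps (eta_weight X) (eta_quotient X) \<longleftrightarrow> (\<forall>c. cusp_order X c \<ge> 0)"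
proof -
  have exp_form: "norm (of_int c * z + of_int d) powr (- eta_weight X) *
        norm (eta_quotient X (moebius (of_int a) (of_int b) (of_int c) (of_int d) z))
      = exp (ln (norm (eta_quotient X (moebius (of_int a) (of_int b) (of_int c) (of_int d) z)))
        - eta_weight X * ln (norm (of_int c * z + of_int d :: complex)))"
    if det: "a * d - b * c = 1" and z: "Im z > 0" for a b c d :: int and z
  proof -
    have "c \<noteq> 0 \<or> d \<noteq> 0" using det by auto
    then have nz: "of_int c * z + of_int d \<noteq> 0" using cz_add_d_nonzero z by blast
    then have "Im (moebius (of_int a) (of_int b) (of_int c) (of_int d) z) > 0"
      unfolding Im_moebius[OF det] using z by simp
    then show ?thesis using nz ln_norm_eta_quotient(2)[OF X]
      by (simp add: powr_def exp_diff exp_minus field_simps)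
  qed
  show ?thesis
  proof
    assume L: "no_poles_at_cusps (eta_weight X) (eta_quotient X)"
    show "\<forall>c. cusp_order X c \<ge> 0"
    proof (rule allI, rule ccontr)
      fix c assume neg: "\<not> cusp_order X c \<ge> 0"
      \<comment> \<open>Each c occurs as a lower left entry, here of the matrix with rows (1, 0) and
        (c, 1), so a negative order is detected by a single matrix.\<close>
      have det: "1 * 1 - 0 * int c = 1" by simp
      obtain y1 B1 where 1: "y1 > 0" "\<And>z. Im z > y1 \<Longrightarrow> norm (of_int (int c) * z + of_int 1) powr (- eta_weight X) *
          norm (eta_quotient X (moebius (of_int 1) (of_int 0) (of_int (int c)) (of_int 1) z)) \<le> B1"
        using L det unfolding no_poles_at_cusps_def by blast
      obtain y2 B2 where 2: "y2 > 0" "\<And>z. Im z > y2 \<Longrightarrow>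
          \<bar>ln (norm (eta_quotient X (moebius (of_int 1) (of_int 0) (of_int (int c)) (of_int 1) z)))
          - eta_weight X * ln (norm (of_int (int c) * z + of_int 1 :: complex))
          + pi / 12 * cusp_order X (nat \<bar>int c\<bar>) * Im z\<bar> \<le> B2"
        using ln_norm_eta_quotient_at_cusp[OF X det] by blast
      define s where "s = - (pi / 12 * cusp_order X c)"
      have s: "s > 0" using neg by (simp add: s_def mult_pos_neg)
      \<comment> \<open>So far up that \<open>s * t\<close> exceeds |B1| + |B2|: then
        \<open>Q\<close> is larger than |B1|, against
        \<open>1 + Q \<le> exp Q \<le> B1\<close>.\<close>
      define t where "t = max y1 y2 + (\<bar>B1\<bar> + \<bar>B2\<bar>) / s + 1"
      have "(\<bar>B1\<bar> + \<bar>B2\<bar>) / s \<ge> 0" using s by simp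
      then have t: "t > y1" "t > y2" "t > 0" "t > (\<bar>B1\<bar> + \<bar>B2\<bar>) / s" using 1(1) 2(1) by (auto simp: t_def max_def)
      define z where "z = \<i> * complex_of_real t"
      have Im_z: "Im z = t" by (simp add: z_def)
      define Q where "Q = ln (norm (eta_quotient X (moebius (of_int 1) (of_int 0) (of_int (int c)) (of_int 1) z)))
          - eta_weight X * ln (norm (of_int (int c) * z + of_int 1 :: complex))"
      have "exp Q \<le> B1"
        using 1(2)[of z] exp_form[OF det, of z] t unfolding Q_def Im_z by simp
      moreover have "1 + Q \<le> exp Q" by (rule exp_ge_add_one_self)
      moreover have "\<bar>Q - s * t\<bar> \<le> B2"
        using 2(2)[of z] t unfolding Q_def[symmetric] Im_z s_def by (simp add: algebra_simps)
      moreover have "s * t > \<bar>B1\<bar> + \<bar>B2\<bar>" using t(4) s by (simp add: field_simps)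
      ultimately show False by linarith
    qed
  next
    assume R: "\<forall>c. cusp_order X c \<ge> 0"
    show "no_poles_at_cusps (eta_weight X) (eta_quotient X)"
      unfolding no_poles_at_cusps_def
    proof (intro allI impI)
      fix a b c d :: int assume det: "a * d - b * c = 1"
      obtain y B where yB: "y > 0" "\<And>z. Im z > y \<Longrightarrow>
          \<bar>ln (norm (eta_quotient X (moebius (of_int a) (of_int b) (of_int c) (of_int d) z)))
          - eta_weight X * ln (norm (of_int c * z + of_int d :: complex))
          + pi / 12 * cusp_order X (nat \<bar>c\<bar>) * Im z\<bar> \<le> B"
        using ln_norm_eta_quotient_at_cusp[OF X det] by blast
      show "\<exists>y>0. \<exists>B. \<forall>z. y < Im z \<longrightarrow> norm (of_int c * z + of_int d) powr (- eta_weight X) *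
          norm (eta_quotient X (moebius (of_int a) (of_int b) (of_int c) (of_int d) z)) \<le> B"
      proof (rule exI[of _ y], rule conjI[OF yB(1)], rule exI[of _ "exp B"], intro allI impI)
        fix z :: complex assume z: "y < Im z"
        then have Im: "Im z > 0" using yB(1) by simp
        have "pi / 12 * cusp_order X (nat \<bar>c\<bar>) * Im z \<ge> 0" using R Im by simp
        then show "norm (of_int c * z + of_int d) powr (- eta_weight X) *
          norm (eta_quotient X (moebius (of_int a) (of_int b) (of_int c) (of_int d) z)) \<le> exp B"
          unfolding exp_form[OF det Im] exp_le_cancel_iff using yB(2)[OF z] by linarith
      qed
    qed
  qed
qed

text \<open>At this point the weight of a constant eta quotient is not yet known to be zero. But its
  contribution grows only like ln t along z = i t, whereas a nonzero order would give growth linear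
  in t.\<close>

lemma cusp_order_eq_0_of_constant:
  assumes X: "eta_exponents X" and const: "eta_quotient X constant_on {z. Im z > 0}"
  shows "cusp_order X c = 0"
proof -
  obtain K where K: "\<And>z. Im z > 0 \<Longrightarrow> eta_quotient X z = K" using const by (auto simp: constant_on_def)
  have det: "1 * 1 - 0 * int c = 1" by simp
  obtain y B where yB: "y > 0" "\<And>z. Im z > y \<Longrightarrow>
      \<bar>ln (norm (eta_quotient X (moebius (of_int 1) (of_int 0) (of_int (int c)) (of_int 1) z)))
      - eta_weight X * ln (norm (of_int (int c) * z + of_int 1 :: complex))
      + pi / 12 * cusp_order X (nat \<bar>int c\<bar>) * Im z\<bar> \<le> B"
    using ln_norm_eta_quotient_at_cusp[OF X det] by blast
  define C where "C = B + \<bar>ln (norm K)\<bar>"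
  define k where "k = \<bar>eta_weight X\<bar>"
  define r where "r = real c"
  have bound: "pi / 12 * \<bar>cusp_order X c\<bar> \<le> (C + k * ln (1 + r * t)) / t" if t: "t > y" for t
  proof -
    define z where "z = \<i> * complex_of_real t"
    have Im_z: "Im z = t" by (simp add: z_def)
    define N where "N = norm (of_int (int c) * z + of_int 1 :: complex)"
    have "Im (moebius (of_int 1) (of_int 0) (of_int (int c)) (of_int 1) z) > 0"
      unfolding Im_moebius[OF det] using t yB(1) cz_add_d_nonzero[of z "int c" 1] Im_z by simp
    from K[OF this] have main: "\<bar>ln (norm K) - eta_weight X * ln N + pi / 12 * cusp_order X c * t\<bar> \<le> B"
      using yB(2)[of z] t unfolding N_def by (simp add: Im_z)
    have N1: "N \<ge> 1" using complex_Re_le_cmod[of "of_int (int c) * z + of_int 1"] by (simp add: N_def z_def)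
    have N2: "N \<le> 1 + r * t"
      using norm_triangle_ineq[of "of_int (int c) * z" "of_int 1"] t yB(1)
      by (simp add: N_def r_def z_def norm_mult)
    have "\<bar>eta_weight X * ln N\<bar> = k * ln N" using N1 by (simp add: k_def abs_mult)
    also have "\<dots> \<le> k * ln (1 + r * t)" using N1 N2 by (intro mult_left_mono) (auto simp: k_def)
    finally have "\<bar>pi / 12 * cusp_order X c * t\<bar> \<le> C + k * ln (1 + r * t)"
      using main unfolding C_def by linarith
    then show ?thesis using t yB(1) by (simp add: field_simps abs_mult)
  qed
  have "((\<lambda>t. (C + k * ln (1 + r * t)) / t) \<longlongrightarrow> 0) at_top"
  proof (cases "r = 0")
    case True
    then show ?thesis by simp real_asymp
  next
    case False
    then have "r > 0" by (simp add: r_def)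
    then show ?thesis by real_asymp
  qed
  then have "pi / 12 * \<bar>cusp_order X c\<bar> \<le> 0"
    by (rule tendsto_lowerbound[OF _ eventually_mono[OF eventually_gt_at_top[of y] bound]]) auto
  then show ?thesis using pi_gt_zero by (simp add: mult_le_0_iff)
qed

section \<open>The cone of holomorphic exponents\<close>

lemma divisor_coprime_split:
  fixes d M N :: nat
  assumes "coprime M N" "d dvd M * N"
  shows "d = gcd d M * gcd d N"
proof (rule dvd_antisym)
  show "d dvd gcd d M * gcd d N"
  proof -
    obtain a b where "d = a * b" "a dvd M" "b dvd N" using division_decomp[OF assms(2)] by blast
    then show ?thesis by (metis dvd_triv_left dvd_triv_right gcd_greatest mult_dvd_mono)
  qed
  have "coprime (gcd d M) (gcd d N)" using assms(1) by (meson coprime_divisors gcd_dvd2)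
  then show "gcd d M * gcd d N dvd d" by (simp add: divides_mult)
qed

lemma sum_divisors_mult_coprime:
  fixes M N :: nat
  assumes "coprime M N"
  shows "(\<Sum>d | d dvd M * N. f (gcd d M) (gcd d N)) = (\<Sum>a | a dvd M. \<Sum>b | b dvd N. f a b)"
proof -
  have split: "gcd (a * b) M = a" "gcd (a * b) N = b" if "a dvd M" "b dvd N" for a b
  proof -
    have cop: "coprime M b" "coprime N a" using that assms by (meson coprime_commute coprime_divisors dvd_refl)+
    show "gcd (a * b) M = a"
      using gcd_mult_left_right_cancel[OF cop(1)] that by (simp add: gcd_nat.absorb1)
    show "gcd (a * b) N = b"
      using gcd_mult_left_left_cancel[OF cop(2)] that by (simp add: gcd_nat.absorb1)
  qed
  have "(\<Sum>a | a dvd M. \<Sum>b | b dvd N. f a b) = (\<Sum>(a, b) \<in> {a. a dvd M} \<times> {b. b dvd N}. f a b)"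
    by (rule sum.cartesian_product)
  also have "\<dots> = (\<Sum>d | d dvd M * N. f (gcd d M) (gcd d N))"
    by (rule sum.reindex_bij_witness[where i = "\<lambda>d. (gcd d M, gcd d N)" and j = "\<lambda>(a, b). a * b"])
       (auto simp: split mult_dvd_mono divisor_coprime_split[OF assms, symmetric])
  finally show ?thesis by simp
qed

text \<open>The usual criterion multiplies the form at t by the positive number N / gcd(t^2, N).
  Real coefficients are allowed because a vector on a ray is at first only a real multiple of the
  ray vector.\<close>

definition cusp_sum :: "nat \<Rightarrow> (nat \<Rightarrow> real) \<Rightarrow> nat \<Rightarrow> real" where
  "cusp_sum N X s = (\<Sum>d | d dvd N. real (gcd s d) ^ 2 / real d * X d)"

text \<open>\<open>V t\<close> spans the extremal ray of the cone of holomorphic exponent vectors that belongs to the cusp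
  \<open>1 / t\<close>; the coefficients \<open>u t\<close> witness that it is a primitive lattice vector.\<close>

definition ray_basis :: "nat \<Rightarrow> (nat \<Rightarrow> nat \<Rightarrow> int) \<Rightarrow> (nat \<Rightarrow> nat \<Rightarrow> int) \<Rightarrow> bool" where
  "ray_basis N V u \<longleftrightarrow>
    (\<forall>s t. s dvd N \<longrightarrow> t dvd N \<longrightarrow> s \<noteq> t \<longrightarrow> cusp_sum N (\<lambda>d. of_int (V t d)) s = 0) \<and>
    (\<forall>t. t dvd N \<longrightarrow> cusp_sum N (\<lambda>d. of_int (V t d)) t > 0) \<and>
    (\<forall>t. t dvd N \<longrightarrow> (\<Sum>d | d dvd N. u t d * V t d) = 1) \<and>
    (\<Sum>t | t dvd N. \<Sum>d | d dvd N. V t d) = int (kappa N)"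

lemma kappa_altdef: "kappa N = (\<Prod>p\<in>prime_factors N. (p - 1) * ((multiplicity p N - 1) * (p - 1) + 2))"
proof -
  have "totient (rad N) = (\<Prod>p\<in>prime_factors N. totient p)"
    unfolding rad_def by (rule totient_prod_coprime) (auto simp: pairwise_def in_prime_factors_iff intro: primes_coprime)
  also have "\<dots> = (\<Prod>p\<in>prime_factors N. p - 1)"
    by (intro prod.cong refl totient_prime) auto
  finally show ?thesis by (simp only: kappa_def prod.distrib)
qed

lemma kappa_mult_coprime:
  assumes "coprime M N" "M > 0" "N > 0"
  shows "kappa (M * N) = kappa M * kappa N"
proof -
  have disj: "prime_factors M \<inter> prime_factors N = {}"
    using assms(1) by (auto simp: in_prime_factors_iff) (meson coprime_common_divisor not_prime_unit)
  have "multiplicity p (M * N) = multiplicity p M" if "p \<in> prime_factors M" for p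
  proof -
    have "prime p" "\<not> p dvd N" using that disj assms by (auto simp: in_prime_factors_iff)
    then show ?thesis using assms
      by (simp add: prime_elem_multiplicity_mult_distrib not_dvd_imp_multiplicity_0)
  qed
  moreover have "multiplicity p (M * N) = multiplicity p N" if "p \<in> prime_factors N" for p
  proof -
    have "prime p" "\<not> p dvd M" using that disj assms by (auto simp: in_prime_factors_iff)
    then show ?thesis using assms
      by (simp add: prime_elem_multiplicity_mult_distrib not_dvd_imp_multiplicity_0)
  qed
  moreover have "prime_factors (M * N) = prime_factors M \<union> prime_factors N"
    using assms by (simp add: prime_factors_product)
  ultimately show ?thesis
    unfolding kappa_altdef by (simp add: prod.union_disjoint[OF _ _ disj])
qed

lemma kappa_prime_power:
  assumes "prime p" "n > 0"
  shows "kappa (p ^ n) = (p - 1) * ((n - 1) * (p - 1) + 2)"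
  using assms unfolding kappa_altdef by (simp add: prime_factors_power prime_prime_factors)

lemma cusp_sum_mult_coprime:
  fixes M N :: nat
  assumes "coprime M N" "s dvd M * N"
  shows "cusp_sum (M * N) (\<lambda>d. X (gcd d M) * Y (gcd d N)) s = cusp_sum M X (gcd s M) * cusp_sum N Y (gcd s N)"
proof -
  have "cusp_sum (M * N) (\<lambda>d. X (gcd d M) * Y (gcd d N)) s =
    (\<Sum>d | d dvd M * N. (real (gcd (gcd s M) (gcd d M)) ^ 2 / real (gcd d M) * X (gcd d M)) *
       (real (gcd (gcd s N) (gcd d N)) ^ 2 / real (gcd d N) * Y (gcd d N)))"
    unfolding cusp_sum_def
  proof (intro sum.cong refl)
    fix d assume "d \<in> {d. d dvd M * N}"
    then have d: "d dvd M * N" by simp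
    have "gcd s d dvd M * N" using d by (meson dvd_trans gcd_dvd2)
    then have "gcd s d = gcd (gcd s d) M * gcd (gcd s d) N" by (rule divisor_coprime_split[OF assms(1)])
    also have "gcd (gcd s d) M = gcd (gcd s M) (gcd d M)" by (simp add: gcd.left_commute gcd.commute)
    also have "gcd (gcd s d) N = gcd (gcd s N) (gcd d N)" by (simp add: gcd.left_commute gcd.commute)
    finally have g: "real (gcd s d) = real (gcd (gcd s M) (gcd d M)) * real (gcd (gcd s N) (gcd d N))"
      by (metis of_nat_mult)
    have d': "real d = real (gcd d M) * real (gcd d N)"
      using divisor_coprime_split[OF assms(1) d] by (metis of_nat_mult)
    show "(real (gcd s d))\<^sup>2 / real d * (X (gcd d M) * Y (gcd d N)) =
       (real (gcd (gcd s M) (gcd d M)) ^ 2 / real (gcd d M) * X (gcd d M)) *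
       (real (gcd (gcd s N) (gcd d N)) ^ 2 / real (gcd d N) * Y (gcd d N))"
      unfolding g d' by (simp add: power_mult_distrib)
  qed
  also have "\<dots> = cusp_sum M X (gcd s M) * cusp_sum N Y (gcd s N)"
    unfolding sum_divisors_mult_coprime[OF assms(1), of "\<lambda>a b. (real (gcd (gcd s M) a) ^ 2 / real a * X a) *
       (real (gcd (gcd s N) b) ^ 2 / real b * Y b)"] cusp_sum_def sum_product ..
  finally show ?thesis .
qed

text \<open>Divisors of M N are pairs of divisors. Distinct s and t differ in one component, where
  the corresponding factor vanishes; the functionals and the total weights multiply, the latter in
  accordance with \<open>kappa_mult_coprime\<close>.\<close>

lemma ray_basis_mult_coprime:
  assumes cop: "coprime M N" and pos: "M > 0" "N > 0"
    and M: "ray_basis M V u" and N: "ray_basis N V' u'"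
  shows "ray_basis (M * N) (\<lambda>t d. V (gcd t M) (gcd d M) * V' (gcd t N) (gcd d N))
    (\<lambda>t d. u (gcd t M) (gcd d M) * u' (gcd t N) (gcd d N))"
  unfolding ray_basis_def
proof (intro conjI allI impI)
  fix s t assume s: "s dvd M * N" and t: "t dvd M * N" and st: "s \<noteq> t"
  have "gcd s M \<noteq> gcd t M \<or> gcd s N \<noteq> gcd t N"
    using st divisor_coprime_split[OF cop s] divisor_coprime_split[OF cop t] by metis
  then have "cusp_sum M (\<lambda>d. of_int (V (gcd t M) d)) (gcd s M) = 0 \<or> cusp_sum N (\<lambda>d. of_int (V' (gcd t N) d)) (gcd s N) = 0"
    using M N unfolding ray_basis_def by auto
  then show "cusp_sum (M * N) (\<lambda>d. of_int (V (gcd t M) (gcd d M) * V' (gcd t N) (gcd d N))) s = 0"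
    unfolding of_int_mult cusp_sum_mult_coprime[OF cop s, of "\<lambda>d. of_int (V (gcd t M) d)" "\<lambda>d. of_int (V' (gcd t N) d)"] by auto
next
  fix t assume t: "t dvd M * N"
  show "cusp_sum (M * N) (\<lambda>d. of_int (V (gcd t M) (gcd d M) * V' (gcd t N) (gcd d N))) t > 0"
    using M N unfolding of_int_mult cusp_sum_mult_coprime[OF cop t, of "\<lambda>d. of_int (V (gcd t M) d)" "\<lambda>d. of_int (V' (gcd t N) d)"]
      ray_basis_def by simp
next
  fix t assume t: "t dvd M * N"
  have "(\<Sum>d | d dvd M * N. u (gcd t M) (gcd d M) * u' (gcd t N) (gcd d N) * (V (gcd t M) (gcd d M) * V' (gcd t N) (gcd d N)))
    = (\<Sum>a | a dvd M. \<Sum>b | b dvd N. (u (gcd t M) a * V (gcd t M) a) * (u' (gcd t N) b * V' (gcd t N) b))"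
    by (subst sum_divisors_mult_coprime[OF cop, symmetric]) (simp add: mult_ac)
  also have "\<dots> = 1"
    using M N unfolding sum_product[symmetric] ray_basis_def by simp
  finally show "(\<Sum>d | d dvd M * N. u (gcd t M) (gcd d M) * u' (gcd t N) (gcd d N) * (V (gcd t M) (gcd d M) * V' (gcd t N) (gcd d N))) = 1" .
next
  have "(\<Sum>t | t dvd M * N. \<Sum>d | d dvd M * N. V (gcd t M) (gcd d M) * V' (gcd t N) (gcd d N))
    = (\<Sum>s | s dvd M. \<Sum>t | t dvd N. \<Sum>a | a dvd M. \<Sum>b | b dvd N. V s a * V' t b)"
    by (subst sum_divisors_mult_coprime[OF cop, symmetric], subst sum_divisors_mult_coprime[OF cop, symmetric]) simp
  also have "\<dots> = (\<Sum>s | s dvd M. \<Sum>a | a dvd M. V s a) * (\<Sum>t | t dvd N. \<Sum>b | b dvd N. V' t b)"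
    by (simp add: sum_product)
  also have "\<dots> = int (kappa (M * N))"
    using M N unfolding kappa_mult_coprime[OF cop pos] ray_basis_def by simp
  finally show "(\<Sum>t | t dvd M * N. \<Sum>d | d dvd M * N. V (gcd t M) (gcd d M) * V' (gcd t N) (gcd d N)) = int (kappa (M * N))" .
qed

section \<open>Explicit rays for prime powers, and invertibility\<close>

text \<open>Here k is the exponent of the cusp and j that of the divisor. As gcd(p^i, p^j)^2 / p^j =
  p^i p^(-|i - j|), the matrix is, up to scaling of its rows, p^(-|i - j|), whose inverse is
  tridiagonal. These are the columns of that inverse, scaled to primitive integer vectors.\<close>

definition prime_power_ray :: "nat \<Rightarrow> nat \<Rightarrow> nat \<Rightarrow> nat \<Rightarrow> int" where
  "prime_power_ray p n k j =
    (if k = 0 then (if j = 0 then int p else if j = 1 then -1 else 0)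
     else if k = n then (if j = n then int p else if j = n - 1 then -1 else 0)
     else (if j = k then int p ^ 2 + 1 else if j = k - 1 \<or> j = k + 1 then - int p else 0))"

text \<open>Pairing with an arbitrary g serves three purposes: orders at cusps, the value of the
  primitive functional, and the weight (g = 1).\<close>

lemma sum_prime_power_ray:
  fixes g :: "nat \<Rightarrow> 'a :: comm_ring_1"
  assumes "n > 0" "k \<le> n"
  shows "(\<Sum>j\<le>n. g j * of_int (prime_power_ray p n k j)) =
    (if k = 0 then of_nat p * g 0 - g 1
     else if k = n then of_nat p * g n - g (n - 1)
     else (of_nat p ^ 2 + 1) * g k - of_nat p * g (k - 1) - of_nat p * g (k + 1))"
proof -
  consider "k = 0" | "k = n" "k \<noteq> 0" | "0 < k" "k < n" using assms by linarith
  then show ?thesis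
  proof cases
    case 1
    have "(\<Sum>j\<le>n. g j * of_int (prime_power_ray p n k j)) = (\<Sum>j\<in>{0, 1}. g j * of_int (prime_power_ray p n k j))"
      by (rule sum.mono_neutral_right) (use assms 1 in \<open>auto simp: prime_power_ray_def\<close>)
    then show ?thesis using 1 by (simp add: prime_power_ray_def mult.commute)
  next
    case 2
    have "(\<Sum>j\<le>n. g j * of_int (prime_power_ray p n k j)) = (\<Sum>j\<in>{n - 1, n}. g j * of_int (prime_power_ray p n k j))"
      by (rule sum.mono_neutral_right) (use assms 2 in \<open>auto simp: prime_power_ray_def\<close>)
    moreover have "n - 1 \<noteq> n" using assms by simp
    ultimately show ?thesis using 2 assms by (simp add: prime_power_ray_def mult.commute)
  next
    case 3
    have "(\<Sum>j\<le>n. g j * of_int (prime_power_ray p n k j)) = (\<Sum>j\<in>{k - 1, k, k + 1}. g j * of_int (prime_power_ray p n k j))"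
      by (rule sum.mono_neutral_right) (use assms 3 in \<open>auto simp: prime_power_ray_def\<close>)
    moreover have "k - 1 \<noteq> k" "k - 1 \<noteq> k + 1" using 3 by auto
    ultimately show ?thesis using 3 by (simp add: prime_power_ray_def algebra_simps)
  qed
qed

lemma sum_divisors_prime_power:
  fixes p :: nat
  assumes "prime p"
  shows "(\<Sum>d | d dvd p ^ n. f d) = (\<Sum>j\<le>n. f (p ^ j))"
proof -
  have "inj_on ((^) p) {..n}" using prime_gt_1_nat[OF assms] by (auto intro!: inj_onI)
  moreover have "{d. d dvd p ^ n} = (^) p ` {..n}" using divides_primepow_nat[OF assms] by auto
  ultimately show ?thesis by (simp add: sum.reindex)
qed

text \<open>On either side of the cusp i the kernel is proportional to p^j or to p^(-j). Both solve
  the interior recurrence (p^2 + 1) g(k) = p g(k - 1) + p g(k + 1), and each end condition is solved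
  by the one that is relevant there; hence the form vanishes unless i = k. The functional gives 1
  because (-1)(-1) = 1 at the ends and p (-p) + (p^2 + 1) = 1 in the interior.\<close>

lemma ray_basis_prime_power:
  assumes p: "prime p" and n: "n > 0"
  shows "ray_basis (p ^ n) (\<lambda>t d. prime_power_ray p n (multiplicity p t) (multiplicity p d))
    (\<lambda>t d. let k = multiplicity p t; j = multiplicity p d in
       if k = 0 then (if j = 1 then -1 else 0)
       else if k = n then (if j = n - 1 then -1 else 0)
       else (if j = k - 1 then int p else if j = k then 1 else 0))"
proof -
  define P where "P = real p"
  have P: "P > 1" using prime_gt_1_nat[OF p] by (simp add: P_def)
  have mult: "multiplicity p (p ^ k) = k" for k using p by simp
  have cs: "cusp_sum (p ^ n) (\<lambda>d. of_int (prime_power_ray p n (multiplicity p (p ^ k)) (multiplicity p d))) (p ^ i)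
    = (let g = (\<lambda>j. (P ^ min i j) ^ 2 / P ^ j) in
       if k = 0 then P * g 0 - g 1
       else if k = n then P * g n - g (n - 1)
       else (P ^ 2 + 1) * g k - P * g (k - 1) - P * g (k + 1))" if "k \<le> n" for k i
  proof -
    have gcd: "gcd (p ^ i) (p ^ j) = p ^ min i j" for j
      by (cases "i \<le> j") (auto simp: min_def gcd_nat.absorb1 gcd_nat.absorb2 le_imp_power_dvd)
    have "cusp_sum (p ^ n) (\<lambda>d. of_int (prime_power_ray p n (multiplicity p (p ^ k)) (multiplicity p d))) (p ^ i)
      = (\<Sum>j\<le>n. (P ^ min i j) ^ 2 / P ^ j * of_int (prime_power_ray p n k j))"
      unfolding cusp_sum_def sum_divisors_prime_power[OF p] mult gcd by (simp add: P_def)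
    then show ?thesis
      unfolding sum_prime_power_ray[OF n that] by (simp add: P_def Let_def)
  qed
  have dvd: "\<exists>k\<le>n. t = p ^ k" if "t dvd p ^ n" for t using that divides_primepow_nat[OF p] by blast
  show ?thesis unfolding ray_basis_def
  proof (intro conjI allI impI)
    fix s t assume "s dvd p ^ n" "t dvd p ^ n" "s \<noteq> t"
    then obtain i k where ik: "s = p ^ i" "t = p ^ k" "i \<le> n" "k \<le> n" "i \<noteq> k" using dvd by metis
    show "cusp_sum (p ^ n) (\<lambda>d. of_int (prime_power_ray p n (multiplicity p t) (multiplicity p d))) s = 0"
    proof -
      consider "k = 0" | "k = n" "k \<noteq> 0" | "0 < k" "k < n" using ik by linarith
      then show ?thesis
      proof cases
        case 1
        then have "min i 0 = 0" "min i 1 = 1" using ik by auto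
        then show ?thesis unfolding ik(1,2) cs[OF ik(4)] using 1 P by (simp add: Let_def power2_eq_square)
      next
        case 2
        then have "min i n = i" "min i (n - 1) = i" using ik by auto
        moreover have "P ^ n = P * P ^ (n - 1)" using n by (simp add: power_eq_if)
        ultimately show ?thesis unfolding ik(1,2) cs[OF ik(4)] using 2 P by (simp add: Let_def)
      next
        case 3
        then obtain l where l: "k = Suc l" using gr0_implies_Suc by blast
        consider "i < k" | "i > k" using ik by linarith
        then show ?thesis
        proof cases
          case 1
          then have "min i k = i" "min i (k - 1) = i" "min i (k + 1) = i" by auto
          then show ?thesis unfolding ik(1,2) cs[OF ik(4)] using 3 P
            by (simp add: Let_def l field_simps power2_eq_square)
        next
          case 2
          then have "min i k = k" "min i (k - 1) = k - 1" "min i (k + 1) = k + 1" by auto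
          then show ?thesis unfolding ik(1,2) cs[OF ik(4)] using 3 P
            by (simp add: Let_def l field_simps power2_eq_square)
        qed
      qed
    qed
  next
    fix t assume "t dvd p ^ n"
    then obtain k where k: "t = p ^ k" "k \<le> n" using dvd by metis
    show "cusp_sum (p ^ n) (\<lambda>d. of_int (prime_power_ray p n (multiplicity p t) (multiplicity p d))) t > 0"
    proof -
      consider "k = 0" | "k = n" "k \<noteq> 0" | "0 < k" "k < n" using k by linarith
      then show ?thesis
      proof cases
        case 1
        have "1 / P < P" using P by (simp add: field_simps) (metis less_1_mult)
        then show ?thesis unfolding k(1) cs[OF k(2)] using 1 by (simp add: Let_def)
      next
        case 2
        then obtain l where l: "n = Suc l" using gr0_implies_Suc n by blast
        have "P * (P * P ^ l) > 1 * P ^ l" using P by (simp add: mult.assoc[symmetric] less_1_mult)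
        then show ?thesis unfolding k(1) cs[OF k(2)] using 2 P by (simp add: Let_def l power2_eq_square)
      next
        case 3
        then obtain l where l: "k = Suc l" using gr0_implies_Suc by blast
        have "P * P > 1" using P by (rule less_1_mult[OF P])
        then have "P ^ k * (P * P) > P ^ k * 1" using P by (intro mult_strict_left_mono) auto
        moreover have "(P ^ 2 + 1) * ((P ^ min k k) ^ 2 / P ^ k) - P * ((P ^ min k (k - 1)) ^ 2 / P ^ (k - 1)) - P * ((P ^ min k (k + 1)) ^ 2 / P ^ (k + 1))
          = P ^ k * (P * P) - P ^ k"
          using P by (simp add: l field_simps power2_eq_square)
        ultimately show ?thesis unfolding k(1) cs[OF k(2)] Let_def using 3 by simp
      qed
    qed
  next
    fix t assume "t dvd p ^ n"
    then obtain k where k: "t = p ^ k" "k \<le> n" using dvd by metis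
    show "(\<Sum>d | d dvd p ^ n. (let k = multiplicity p t; j = multiplicity p d in
       if k = 0 then (if j = 1 then -1 else 0)
       else if k = n then (if j = n - 1 then -1 else 0)
       else (if j = k - 1 then int p else if j = k then 1 else 0)) *
        prime_power_ray p n (multiplicity p t) (multiplicity p d)) = 1"
      unfolding sum_divisors_prime_power[OF p] k(1) mult
      using sum_prime_power_ray[OF n k(2), of "\<lambda>j. (let j = j in if k = 0 then (if j = 1 then -1 else 0)
       else if k = n then (if j = n - 1 then -1 else 0)
       else (if j = k - 1 then int p else if j = k then 1 else 0))" p] n
      by (auto simp: Let_def power2_eq_square)
  next
    \<comment> \<open>The two end rays have coefficient sum q and the n - 1 interior ones p^2 + 1 -
      2 p = q^2, which is the origin of the factors of \<open>kappa\<close>.\<close>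
    define q where "q = int p - 1"
    have row: "(\<Sum>j\<le>n. prime_power_ray p n k j) = (if k = 0 \<or> k = n then q else q ^ 2)" if "k \<le> n" for k
      using sum_prime_power_ray[OF n that, of "\<lambda>_. 1 :: int" p]
      by (auto simp: q_def power2_eq_square algebra_simps)
    obtain l where l: "n = Suc l" using gr0_implies_Suc n by blast
    have "(\<Sum>t | t dvd p ^ n. \<Sum>d | d dvd p ^ n. prime_power_ray p n (multiplicity p t) (multiplicity p d))
      = (\<Sum>k\<le>n. if k = 0 \<or> k = n then q else q ^ 2)"
      unfolding sum_divisors_prime_power[OF p] mult using row by (intro sum.cong) auto
    also have "\<dots> = (\<Sum>k\<le>l. if k = 0 then q else q ^ 2) + q"
      unfolding l sum.atMost_Suc by (intro arg_cong2[where f = "(+)"] sum.cong) auto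
    also have "(\<Sum>k\<le>l. if k = 0 then q else q ^ 2) = q + (\<Sum>k<l. q ^ 2)"
      unfolding sum.atMost_shift by simp
    also have "q + (\<Sum>k<l. q ^ 2) + q = int ((p - 1) * ((n - 1) * (p - 1) + 2))"
    proof -
      have "int (p - 1) = q" using prime_gt_1_nat[OF p] by (simp add: q_def of_nat_diff)
      then show ?thesis by (simp only: of_nat_mult of_nat_add) (simp add: l power2_eq_square algebra_simps)
    qed
    finally show "(\<Sum>t | t dvd p ^ n. \<Sum>d | d dvd p ^ n. prime_power_ray p n (multiplicity p t) (multiplicity p d)) = int (kappa (p ^ n))"
      by (simp only: kappa_prime_power[OF p n])
  qed
qed

lemma ray_basis_exists:
  assumes "N > 0"
  shows "\<exists>V u. ray_basis N V u"
  using assms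
proof (induction N rule: less_induct)
  case (less N)
  show ?case
  proof (cases "N = 1")
    case True
    have "ray_basis N (\<lambda>_ _. 1) (\<lambda>_ _. 1)"
      by (simp add: True ray_basis_def cusp_sum_def kappa_altdef)
    then show ?thesis by blast
  next
    case False
    then obtain p where p: "prime p" "p dvd N" using prime_factor_nat by blast
    define n where "n = multiplicity p N"
    have n: "n > 0" using p less.prems unfolding n_def by (simp add: prime_multiplicity_gt_zero_iff)
    obtain M where M: "N = p ^ n * M" "\<not> p dvd M"
      using multiplicity_decompose'[of N p] p less.prems unfolding n_def by (metis not_prime_unit neq0_conv)
    have "M > 0" using M less.prems by (cases "M = 0") auto
    have "p ^ n > 1" using n prime_gt_1_nat[OF p(1)] by (intro one_less_power)
    then have "M < N" using M \<open>M > 0\<close> by simp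
    then obtain V u where "ray_basis M V u" using less.IH \<open>M > 0\<close> by blast
    moreover have "coprime (p ^ n) M" using p M by (simp add: prime_imp_coprime)
    moreover have "p ^ n > 0" using prime_gt_0_nat[OF p(1)] by simp
    ultimately show ?thesis
      using ray_basis_mult_coprime[OF _ _ \<open>M > 0\<close> ray_basis_prime_power[OF p(1) n]] unfolding M(1) by blast
  qed
qed

text \<open>Dividing the form at t by t makes the kernel gcd(t, d)^2 / (t d) symmetric. So the ray
  vectors, which diagonalise the matrix on one side, do so on the other side as well, and recover X
  from its forms.\<close>

lemma cusp_sum_injective:
  assumes N: "N > 0" and zero: "\<And>t. t dvd N \<Longrightarrow> cusp_sum N X t = 0" and s: "s dvd N"
  shows "X s = 0"
proof -
  obtain V u where V: "ray_basis N V u" using ray_basis_exists[OF N] by blast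
  define D where "D = {d. d dvd N}"
  have D: "finite D" "s \<in> D" using N s by (auto simp: D_def)
  have "0 = (\<Sum>t\<in>D. of_int (V s t) / real t * cusp_sum N X t)"
    using zero by (simp add: D_def)
  also have "\<dots> = (\<Sum>t\<in>D. \<Sum>d\<in>D. X d / real d * (real (gcd d t) ^ 2 / real t * of_int (V s t)))"
    unfolding cusp_sum_def D_def[symmetric] sum_distrib_left
    by (intro sum.cong refl) (simp add: gcd.commute mult_ac)
  also have "\<dots> = (\<Sum>d\<in>D. X d / real d * cusp_sum N (\<lambda>t. of_int (V s t)) d)"
    unfolding cusp_sum_def D_def[symmetric] sum_distrib_left by (rule sum.swap)
  also have "\<dots> = (\<Sum>d\<in>D. if d = s then X s / real s * cusp_sum N (\<lambda>t. of_int (V s t)) s else 0)"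
    using V s unfolding ray_basis_def D_def by (intro sum.cong) auto
  also have "\<dots> = X s / real s * cusp_sum N (\<lambda>t. of_int (V s t)) s" using D by simp
  finally have "X s / real s * cusp_sum N (\<lambda>t. of_int (V s t)) s = 0" by simp
  moreover have "cusp_sum N (\<lambda>t. of_int (V s t)) s > 0" using V s unfolding ray_basis_def by blast
  moreover have "s > 0" using s N by (simp add: dvd_pos_nat)
  ultimately show ?thesis by simp
qed

section \<open>Eta quotients and their exponents\<close>

lemma eta_quotient_eq_prod:
  assumes "finite S" "{d. X d \<noteq> 0} \<subseteq> S" "Im z > 0"
  shows "eta_quotient X z = (\<Prod>d\<in>S. dedekind_eta (of_nat d * z) powi X d)"
  unfolding eta_quotient_def using assms by (auto intro!: prod.mono_neutral_left)

lemma eta_exponents_add: "eta_exponents X \<Longrightarrow> eta_exponents Y \<Longrightarrow> eta_exponents (\<lambda>d. X d + Y d)"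
  unfolding eta_exponents_def
  by (auto intro: finite_subset[of _ "{d. X d \<noteq> 0} \<union> {d. Y d \<noteq> 0}"])

lemma eta_exponents_diff: "eta_exponents X \<Longrightarrow> eta_exponents Y \<Longrightarrow> eta_exponents (\<lambda>d. X d - Y d)"
  unfolding eta_exponents_def
  by (auto intro: finite_subset[of _ "{d. X d \<noteq> 0} \<union> {d. Y d \<noteq> 0}"])

lemma eta_quotient_mult:
  assumes "eta_exponents X" "eta_exponents Y"
  shows "(\<lambda>z. eta_quotient X z * eta_quotient Y z) = eta_quotient (\<lambda>d. X d + Y d)"
proof
  fix z
  define S where "S = {d. X d \<noteq> 0} \<union> {d. Y d \<noteq> 0}"
  have S: "finite S" "0 \<notin> S" using assms by (auto simp: S_def eta_exponents_def)
  show "eta_quotient X z * eta_quotient Y z = eta_quotient (\<lambda>d. X d + Y d) z"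
  proof (cases "Im z > 0")
    case True
    have "dedekind_eta (of_nat d * z) \<noteq> 0" if "d \<in> S" for d
      using that S(2) True by (intro dedekind_eta_nonzero) (cases "d = 0", auto)
    moreover have "{d. X d \<noteq> 0} \<subseteq> S" "{d. Y d \<noteq> 0} \<subseteq> S" "{d. X d + Y d \<noteq> 0} \<subseteq> S"
      by (auto simp: S_def)
    ultimately show ?thesis
      by (simp add: eta_quotient_eq_prod[OF S(1) _ True] power_int_add flip: prod.distrib)
  qed (simp add: eta_quotient_def)
qed

lemma eta_quotient_divide:
  assumes "eta_exponents X" "eta_exponents Y"
  shows "(\<lambda>z. eta_quotient X z / eta_quotient Y z) = eta_quotient (\<lambda>d. X d - Y d)"
proof
  fix z
  have "eta_quotient X z = eta_quotient (\<lambda>d. X d - Y d) z * eta_quotient Y z"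
    using fun_cong[OF eta_quotient_mult[OF eta_exponents_diff[OF assms] assms(2)], of z] by simp
  then show "eta_quotient X z / eta_quotient Y z = eta_quotient (\<lambda>d. X d - Y d) z"
    using ln_norm_eta_quotient(2)[OF assms(2), of z] by (cases "Im z > 0") (auto simp: eta_quotient_def)
qed

definition supported_on_divisors :: "nat \<Rightarrow> (nat \<Rightarrow> int) \<Rightarrow> bool" where
  "supported_on_divisors N X \<longleftrightarrow> (\<forall>d. X d \<noteq> 0 \<longrightarrow> d dvd N)"

lemma eta_exponents_of_supported:
  assumes "N > 0" "supported_on_divisors N X"
  shows "eta_exponents X"
proof -
  have "{d. X d \<noteq> 0} \<subseteq> {d. d dvd N}" using assms(2) by (auto simp: supported_on_divisors_def)
  then have "finite {d. X d \<noteq> 0}" using finite_subset assms(1) by (metis finite_divisors_nat)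
  moreover have "X 0 = 0" using assms by (force simp: supported_on_divisors_def)
  ultimately show ?thesis by (simp add: eta_exponents_def)
qed

lemma eta_quotient_on_iff:
  assumes "N > 0"
  shows "eta_quotient_on N f \<longleftrightarrow> (\<exists>X. supported_on_divisors N X \<and> f = eta_quotient X)"
proof -
  have "eta_level X dvd N \<longleftrightarrow> supported_on_divisors N X" for X
    by (auto simp: eta_level_def supported_on_divisors_def Lcm_dvd_iff)
  then show ?thesis
    using eta_exponents_of_supported[OF assms] by (metis eta_quotient_on_def)
qed

lemma cusp_order_eq_cusp_sum:
  assumes "N > 0" "supported_on_divisors N X"
  shows "cusp_order X c = cusp_sum N (\<lambda>d. of_int (X d)) (gcd c N)"
proof -
  have "gcd (gcd c N) d = gcd c d" if "d dvd N" for d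
    using that by (metis gcd.assoc gcd_nat.absorb2)
  then have "cusp_sum N (\<lambda>d. of_int (X d)) (gcd c N) = (\<Sum>d | d dvd N. real (gcd c d) ^ 2 / real d * of_int (X d))"
    unfolding cusp_sum_def by (intro sum.cong) auto
  also have "\<dots> = cusp_order X c"
    unfolding cusp_order_def using assms
    by (intro sum.mono_neutral_right) (auto simp: supported_on_divisors_def)
  finally show ?thesis ..
qed

lemma eta_quotient_constant_imp_zero:
  assumes X: "eta_exponents X" and const: "eta_quotient X constant_on {z. Im z > 0}"
  shows "X d = 0"
proof (rule ccontr)
  assume d: "X d \<noteq> 0"
  \<comment> \<open>Any common multiple of the finitely many indices serves as a level.\<close>
  define N where "N = \<Prod>{d. X d \<noteq> 0}"
  have fin: "finite {d. X d \<noteq> 0}" and X0: "X 0 = 0" using X by (auto simp: eta_exponents_def)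
  have N: "N > 0" unfolding N_def using X0 by (intro prod_pos) (auto intro: gr0I)
  have sup: "supported_on_divisors N X"
    unfolding supported_on_divisors_def N_def using fin by (auto intro: dvd_prod_eqI)
  have "cusp_sum N (\<lambda>d. of_int (X d)) t = 0" if "t dvd N" for t
    using cusp_order_eq_0_of_constant[OF X const, of t] cusp_order_eq_cusp_sum[OF N sup, of t] that
    by (simp add: gcd_nat.absorb1)
  moreover have "d dvd N" using sup d by (simp add: supported_on_divisors_def)
  ultimately have "real_of_int (X d) = 0" by (rule cusp_sum_injective[OF N])
  then show False using d by simp
qed

lemma eta_quotient_inject:
  assumes X: "eta_exponents X" and Y: "eta_exponents Y" and eq: "eta_quotient X = eta_quotient Y"
  shows "X = Y"
proof
  fix d
  have "eta_quotient (\<lambda>d. X d - Y d) z = 1" if "Im z > 0" for z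
    using fun_cong[OF eta_quotient_divide[OF X Y], of z] ln_norm_eta_quotient(2)[OF Y that] by (simp add: eq)
  then have "eta_quotient (\<lambda>d. X d - Y d) constant_on {z. Im z > 0}"
    by (auto simp: constant_on_def)
  then show "X d = Y d"
    using eta_quotient_constant_imp_zero[OF eta_exponents_diff[OF X Y]] by simp
qed

text \<open>Uniqueness of the exponents identifies the weight in the definition as
  \<open>eta_weight X\<close>; the form at an arbitrary c depends only on gcd(c, N), so the divisors
  of N suffice.\<close>

lemma holomorphic_eta_quotient_iff:
  assumes N: "N > 0" and X: "supported_on_divisors N X"
  shows "holomorphic_eta_quotient (eta_quotient X) \<longleftrightarrow> (\<forall>t. t dvd N \<longrightarrow> cusp_sum N (\<lambda>d. of_int (X d)) t \<ge> 0)"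
proof -
  have exps: "eta_exponents X" by (rule eta_exponents_of_supported[OF N X])
  have "holomorphic_eta_quotient (eta_quotient X) \<longleftrightarrow> no_poles_at_cusps (eta_weight X) (eta_quotient X)"
    unfolding holomorphic_eta_quotient_def has_eta_weight_def using eta_quotient_inject[OF exps] exps by metis
  also have "\<dots> \<longleftrightarrow> (\<forall>c. cusp_sum N (\<lambda>d. of_int (X d)) (gcd c N) \<ge> 0)"
    by (simp add: no_poles_at_cusps_iff[OF exps] cusp_order_eq_cusp_sum[OF N X])
  also have "\<dots> \<longleftrightarrow> (\<forall>t. t dvd N \<longrightarrow> cusp_sum N (\<lambda>d. of_int (X d)) t \<ge> 0)"
    by (metis gcd_dvd2 gcd_nat.absorb1)
  finally show ?thesis .
qed

lemma cusp_sum_add: "cusp_sum N (\<lambda>d. X d + Y d) t = cusp_sum N X t + cusp_sum N Y t"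
  and cusp_sum_diff: "cusp_sum N (\<lambda>d. X d - Y d) t = cusp_sum N X t - cusp_sum N Y t"
  and cusp_sum_cmult: "cusp_sum N (\<lambda>d. r * X d) t = r * cusp_sum N X t"
  by (simp_all add: cusp_sum_def algebra_simps add_divide_distrib diff_divide_distrib sum.distrib sum_subtractf sum_distrib_left)

lemma cusp_sum_cong: "(\<And>d. d dvd N \<Longrightarrow> X d = Y d) \<Longrightarrow> cusp_sum N X t = cusp_sum N Y t"
  by (simp add: cusp_sum_def)

lemma cusp_sum_sum: "cusp_sum N (\<lambda>d. \<Sum>i\<in>I. X i d) t = (\<Sum>i\<in>I. cusp_sum N (X i) t)"
  unfolding cusp_sum_def sum_distrib_left by (rule sum.swap)

lemma supported_on_divisors_diff:
  "supported_on_divisors N X \<Longrightarrow> supported_on_divisors N Y \<Longrightarrow> supported_on_divisors N (\<lambda>d. X d - Y d)"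
  by (force simp: supported_on_divisors_def)

theorem theorem2:
  fixes N :: nat
  assumes "N > 0"
  shows "\<exists>F. holomorphic_eta_quotient_on N F \<and> has_eta_weight F (of_nat (kappa N) / 2) \<and>
           (\<forall>h. holomorphic_eta_quotient_on N h \<longrightarrow>
             (eta_divisible_by h F \<longleftrightarrow>
              (\<forall>g. holomorphic_eta_quotient_on N g \<and> \<not> eta_factorizable_on N g \<longrightarrow>
                   eta_divisible_by h g)))"
proof -
  note N = assms
  obtain V u where V: "ray_basis N V u" using ray_basis_exists[OF N] by blast
  define D where "D = {d. d dvd N}"
  have D: "finite D" using N by (simp add: D_def)
  define S where "S X t = cusp_sum N (\<lambda>d. of_int (X d)) t" for X :: "nat \<Rightarrow> int" and t
  \<comment> \<open>\<open>ray_basis\<close> says nothing about \<open>V t\<close> outside the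
    divisors of N, so it is cut off there.\<close>
  define v where "v t d = (if d dvd N then V t d else 0)" for t d
  define F where "F d = (\<Sum>t\<in>D. v t d)" for d
  have sv: "supported_on_divisors N (v t)" for t by (auto simp: v_def supported_on_divisors_def)
  have sF: "supported_on_divisors N F"
    by (auto simp: F_def v_def supported_on_divisors_def intro: ccontr)
  note exps = eta_exponents_of_supported[OF N]
  have S_add: "S (\<lambda>d. X d + Y d) t = S X t + S Y t" and S_diff: "S (\<lambda>d. X d - Y d) t = S X t - S Y t" for X Y t
    by (simp_all add: S_def cusp_sum_add cusp_sum_diff)
  have Sv: "S (v t) s = cusp_sum N (\<lambda>d. of_int (V t d)) s" for s t
    unfolding S_def by (rule cusp_sum_cong) (simp add: v_def)
  have Sv0: "S (v t) s = 0" if "s dvd N" "t dvd N" "s \<noteq> t" for s t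
    using V that unfolding Sv ray_basis_def by blast
  have Svpos: "S (v t) t > 0" if "t dvd N" for t
    using V that unfolding Sv ray_basis_def by blast
  have SF: "S F s = S (v s) s" if s: "s dvd N" for s
  proof -
    have "S F s = (\<Sum>t\<in>D. S (v t) s)"
      unfolding S_def F_def of_int_sum by (rule cusp_sum_sum)
    also have "\<dots> = (\<Sum>t\<in>D. if t = s then S (v s) s else 0)"
      using Sv0[OF s] by (intro sum.cong) (auto simp: D_def)
    finally show ?thesis using D s by (simp add: D_def)
  qed
  have hol: "holomorphic_eta_quotient (eta_quotient X) \<longleftrightarrow> (\<forall>t. t dvd N \<longrightarrow> S X t \<ge> 0)" if "supported_on_divisors N X" for X
    unfolding S_def by (rule holomorphic_eta_quotient_iff[OF N that])
  have hol_on: "holomorphic_eta_quotient_on N f \<longleftrightarrow>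
      (\<exists>X. supported_on_divisors N X \<and> f = eta_quotient X \<and> (\<forall>t. t dvd N \<longrightarrow> S X t \<ge> 0))" for f
    unfolding holomorphic_eta_quotient_on_def eta_quotient_on_iff[OF N] using hol by blast
  \<comment> \<open>Divisibility is the componentwise comparison of orders. What remains to be shown
    is that at each t the order of F is the largest order of a non-factorizable eta
    quotient.\<close>
  have div: "eta_divisible_by (eta_quotient X) (eta_quotient Y) \<longleftrightarrow> (\<forall>t. t dvd N \<longrightarrow> S Y t \<le> S X t)"
    if X: "supported_on_divisors N X" "\<forall>t. t dvd N \<longrightarrow> S X t \<ge> 0"
      and Y: "supported_on_divisors N Y" "\<forall>t. t dvd N \<longrightarrow> S Y t \<ge> 0" for X Y
    unfolding eta_divisible_by_def eta_quotient_divide[OF exps[OF X(1)] exps[OF Y(1)]]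
    using X Y by (simp add: hol supported_on_divisors_diff S_diff)
  have nonconst: "\<not> eta_quotient X constant_on {z. Im z > 0}"
    if "supported_on_divisors N X" "S X t \<noteq> 0" for X t
  proof
    assume "eta_quotient X constant_on {z. Im z > 0}"
    then have "X d = 0" for d by (rule eta_quotient_constant_imp_zero[OF exps[OF that(1)]])
    then show False using that(2) by (simp add: S_def cusp_sum_def)
  qed
  have F0: "\<forall>t. t dvd N \<longrightarrow> S F t \<ge> 0" using SF Svpos by (simp add: less_imp_le)
  have v0: "\<forall>s. s dvd N \<longrightarrow> S (v t) s \<ge> 0" if "t dvd N" for t
    using Sv0 Svpos that by (metis less_imp_le order.refl)
  have weight: "has_eta_weight (eta_quotient F) (of_nat (kappa N) / 2)"
  proof -
    have "(\<Sum>d | F d \<noteq> 0. F d) = (\<Sum>d\<in>D. F d)"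
      using D sF by (intro sum.mono_neutral_left) (auto simp: D_def supported_on_divisors_def)
    also have "\<dots> = (\<Sum>t\<in>D. \<Sum>d\<in>D. v t d)" unfolding F_def by (rule sum.swap)
    also have "\<dots> = (\<Sum>t\<in>D. \<Sum>d\<in>D. V t d)" by (intro sum.cong) (auto simp: v_def D_def)
    also have "\<dots> = int (kappa N)" using V by (simp add: ray_basis_def D_def)
    finally show ?thesis
      unfolding has_eta_weight_def using exps[OF sF] by (intro exI[of _ F]) (simp add: eta_weight_def)
  qed
  have irreducible_le: "S G t \<le> S (v t) t"
    if G: "supported_on_divisors N G" "\<forall>t. t dvd N \<longrightarrow> S G t \<ge> 0" "\<not> eta_factorizable_on N (eta_quotient G)"
      and t: "t dvd N" for G t
  proof (rule ccontr)
    assume gt: "\<not> S G t \<le> S (v t) t"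
    define H where "H d = G d - v t d" for d
    have sH: "supported_on_divisors N H" unfolding H_def by (rule supported_on_divisors_diff[OF G(1) sv])
    have SH: "S H s = S G s - S (v t) s" for s unfolding H_def by (rule S_diff)
    have H0: "\<forall>s. s dvd N \<longrightarrow> S H s \<ge> 0" using G(2) gt Sv0[OF _ t] unfolding SH by (metis diff_ge_0_iff_ge diff_zero linear)
    have "eta_quotient G = (\<lambda>z. eta_quotient (v t) z * eta_quotient H z)"
      unfolding eta_quotient_mult[OF exps[OF sv] exps[OF sH]] by (simp add: H_def)
    moreover have "\<not> eta_quotient (v t) constant_on {z. Im z > 0}"
      using nonconst[OF sv] Svpos[OF t] by (metis less_irrefl)
    \<comment> \<open>The inequality in \<open>gt\<close> is strict, so the cofactor H has positive
      order at t.\<close>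
    moreover have "\<not> eta_quotient H constant_on {z. Im z > 0}"
      using nonconst[OF sH, of t] gt unfolding SH by simp
    ultimately have "eta_factorizable_on N (eta_quotient G)"
      unfolding eta_factorizable_on_def hol_on using sv[of t] sH v0[OF t] H0 by blast
    then show False using G(3) by simp
  qed
  have ray_irreducible: "\<not> eta_factorizable_on N (eta_quotient (v t))" if t: "t dvd N" for t
  proof
    assume "eta_factorizable_on N (eta_quotient (v t))"
    then obtain A B where A: "supported_on_divisors N A" "\<forall>t. t dvd N \<longrightarrow> S A t \<ge> 0" "\<not> eta_quotient A constant_on {z. Im z > 0}"
      and B: "supported_on_divisors N B" "\<forall>t. t dvd N \<longrightarrow> S B t \<ge> 0" "\<not> eta_quotient B constant_on {z. Im z > 0}"
      and eq: "eta_quotient (v t) = (\<lambda>z. eta_quotient A z * eta_quotient B z)"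
      unfolding eta_factorizable_on_def hol_on by blast
    have "v t = (\<lambda>d. A d + B d)"
      using eq unfolding eta_quotient_mult[OF exps[OF A(1)] exps[OF B(1)]]
      by (rule eta_quotient_inject[OF exps[OF sv] eta_exponents_add[OF exps[OF A(1)] exps[OF B(1)]]])
    then have SAB: "S A s + S B s = S (v t) s" for s by (simp add: S_add)
    \<comment> \<open>C lies on the ray of t, so injectivity makes it a real multiple r of
      \<open>v t\<close>. Applying the functional \<open>u t\<close> to the integral vector C shows
      that r is an integer, and it is positive because C is not constant. For A and B this gives two
      positive integers with sum 1.\<close>
    have multiple: "\<exists>k::int. k > 0 \<and> S C t = of_int k * S (v t) t"
      if C: "supported_on_divisors N C" "S C t \<ge> 0" "\<And>s. s dvd N \<Longrightarrow> s \<noteq> t \<Longrightarrow> S C s = 0"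
        "\<not> eta_quotient C constant_on {z. Im z > 0}" for C
    proof -
      define r where "r = S C t / S (v t) t"
      have r: "S C t = r * S (v t) t" using Svpos[OF t] by (simp add: r_def)
      have multiple_of_ray: "of_int (C d) = r * of_int (v t d)" if "d dvd N" for d
      proof -
        have "cusp_sum N (\<lambda>d. of_int (C d) - r * of_int (v t d)) s = 0" if "s dvd N" for s
          using C(3)[OF that] Sv0[OF that t] r
          unfolding cusp_sum_diff cusp_sum_cmult S_def[symmetric] by (cases "s = t") auto
        from cusp_sum_injective[OF N this \<open>d dvd N\<close>] show ?thesis by simp
      qed
      define k where "k = (\<Sum>d\<in>D. u t d * C d)"
      have "of_int k = (\<Sum>d\<in>D. of_int (u t d) * (r * of_int (v t d)))"
        unfolding k_def of_int_sum of_int_mult using multiple_of_ray by (intro sum.cong) (auto simp: D_def)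
      also have "\<dots> = r * of_int (\<Sum>d\<in>D. u t d * V t d)"
        unfolding of_int_sum sum_distrib_left by (intro sum.cong) (auto simp: v_def D_def)
      also have "(\<Sum>d\<in>D. u t d * V t d) = 1" using V t by (simp add: ray_basis_def D_def)
      finally have k: "r = of_int k" by simp
      have "k \<ge> 0" using C(2) Svpos[OF t] k unfolding r by (simp add: zero_le_mult_iff)
      moreover have "k \<noteq> 0"
      proof
        assume "k = 0"
        then have "C d = 0" for d using multiple_of_ray k C(1) by (cases "d dvd N") (auto simp: supported_on_divisors_def)
        then have "eta_quotient C constant_on {z. Im z > 0}"
          by (auto simp: eta_quotient_def constant_on_def)
        then show False using C(4) by simp
      qed
      ultimately show ?thesis using r k by (intro exI[of _ k]) auto
    qed
    \<comment> \<open>Nonnegative orders that add up to zero vanish, so both factors stay on the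
      ray.\<close>
    have zero: "S A s = 0 \<and> S B s = 0" if "s dvd N" "s \<noteq> t" for s
      using SAB[of s] Sv0[OF that(1) t that(2)] A(2) B(2) that(1) by (smt (verit))
    obtain k where k: "k > 0" "S A t = of_int k * S (v t) t" using multiple[OF A(1)] A(2,3) zero t by blast
    obtain l where l: "l > 0" "S B t = of_int l * S (v t) t" using multiple[OF B(1)] B(2,3) zero t by blast
    have "of_int (k + l) * S (v t) t = 1 * S (v t) t" using SAB[of t] k l by (simp add: algebra_simps)
    then have "real_of_int (k + l) = 1" using Svpos[OF t] by (metis less_irrefl mult_right_cancel)
    then show False using k(1) l(1) by linarith
  qed
  show ?thesis
  proof (intro exI[of _ "eta_quotient F"] conjI allI impI iffI weight)
    show "holomorphic_eta_quotient_on N (eta_quotient F)" unfolding hol_on using sF F0 by blast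
  next
    fix h g assume "holomorphic_eta_quotient_on N h" and hF: "eta_divisible_by h (eta_quotient F)"
      and "holomorphic_eta_quotient_on N g \<and> \<not> eta_factorizable_on N g"
    then obtain H G where H: "supported_on_divisors N H" "\<forall>t. t dvd N \<longrightarrow> S H t \<ge> 0" and h: "h = eta_quotient H"
      and G: "supported_on_divisors N G" "\<forall>t. t dvd N \<longrightarrow> S G t \<ge> 0" and g: "g = eta_quotient G"
      and irr: "\<not> eta_factorizable_on N (eta_quotient G)"
      unfolding hol_on by blast
    have "S G t \<le> S H t" if "t dvd N" for t
      using irreducible_le[OF G irr that] hF that unfolding h div[OF H sF F0] by (metis SF order_trans)
    then show "eta_divisible_by h g" unfolding h g div[OF H G] by blast
  next
    fix h assume "holomorphic_eta_quotient_on N h"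
      and all: "\<forall>g. holomorphic_eta_quotient_on N g \<and> \<not> eta_factorizable_on N g \<longrightarrow> eta_divisible_by h g"
    then obtain H where H: "supported_on_divisors N H" "\<forall>t. t dvd N \<longrightarrow> S H t \<ge> 0" and h: "h = eta_quotient H"
      unfolding hol_on by blast
    have "S F t \<le> S H t" if t: "t dvd N" for t
    proof -
      have "holomorphic_eta_quotient_on N (eta_quotient (v t))" unfolding hol_on using sv v0[OF t] by blast
      then have "eta_divisible_by h (eta_quotient (v t))" using all ray_irreducible[OF t] by blast
      then show ?thesis using t unfolding h div[OF H sv v0[OF t]] by (simp add: SF)
    qed
    then show "eta_divisible_by h (eta_quotient F)" unfolding h div[OF H sF F0] by blast
  qed
qed

end
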